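(* Let $\mathbb{D}=\{z\in\mathbb{C}:|z|<1\}$ and let $f=h+\overline{g}$ be a sense-preserving univalent harmonic mapping of $\mathbb{D}$ with $h(z)=z+\sum_{n=2}^\infty a_nz^n$ and $g(z)=\sum_{n=2}^\infty b_nz^n$ (so $f\in\mathcal{S}^0_H$), which is stable univalent, i.e. $h+\mu\overline{g}$ is univalent in $\mathbb{D}$ for every $|\mu|=1$. Let $m,q\in\mathbb{N}$, $\omega_m\in\mathcal{B}_m$ and $\omega_q\in\mathcal{B}_q$. Then for $s,p\in\mathbb{N}$, $$|Df(\omega_m(z))|^s+|f(\omega_q(z))|^p\le1\quad\text{and}\quad|\mathscr{D}f(\omega_m(z))|^s+|f(\omega_q(z))|^p\le1$$ for $|z|=r\le r_{3,s,m,p,q}$, where $r_{3,s,m,p,q}$ is the unique root in $(0,1)$ of $$\frac{r^{sm}(1+r^m)^s}{(1-r^m)^{3s}}+\left(\frac{r^q}{(1-r^q)^2}\right)^p-1=0.$$ The radius $r_{3,s,m,p,q}$ is best possible.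
   Context: For $n\in\mathbb{N}$, $\mathcal{B}_n$ denotes the set of analytic functions $\omega:\mathbb{D}\to\mathbb{C}$ with $|\omega(z)|\le1$ in $\mathbb{D}$, $\omega(0)=\omega'(0)=\cdots=\omega^{(n-1)}(0)=0$ and $\omega^{(n)}(0)\neq0$. For a harmonic $f$, $Df=zf_z-\overline{z}f_{\overline{z}}$ and $\mathscr{D}f=zf_z+\overline{z}f_{\overline{z}}$, and $Df(\omega_m(z))$ means $(Df)(\omega_m(z))$ (similarly for $\mathscr{D}$). "Best possible" means that for every $r>r_{3,s,m,p,q}$ there exist such $f,\omega_m,\omega_q$ and $z$ with $|z|=r$ for which the inequality fails. *)

theory Defs
  imports "HOL-Analysis.Analysis"
begin

definition in_S0H :: "(complex \<Rightarrow> complex) \<Rightarrow> (complex \<Rightarrow> complex) \<Rightarrow> bool" where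
  "in_S0H h g \<longleftrightarrow>
     h holomorphic_on ball 0 1 \<and> g holomorphic_on ball 0 1 \<and>
     h 0 = 0 \<and> deriv h 0 = 1 \<and> g 0 = 0 \<and> deriv g 0 = 0 \<and>
     (\<forall>z\<in>ball 0 1. norm (deriv g z) < norm (deriv h z)) \<and>
     inj_on (\<lambda>z. h z + cnj (g z)) (ball 0 1)"

definition stable_univalent :: "(complex \<Rightarrow> complex) \<Rightarrow> (complex \<Rightarrow> complex) \<Rightarrow> bool" where
  "stable_univalent h g \<longleftrightarrow>
     (\<forall>\<mu>::complex. norm \<mu> = 1 \<longrightarrow> inj_on (\<lambda>z. h z + \<mu> * cnj (g z)) (ball 0 1))"

definition schwarz_B :: "nat \<Rightarrow> (complex \<Rightarrow> complex) \<Rightarrow> bool" where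
  "schwarz_B n \<omega> \<longleftrightarrow>
     \<omega> holomorphic_on ball 0 1 \<and> (\<forall>z\<in>ball 0 1. norm (\<omega> z) \<le> 1) \<and>
     (\<forall>k<n. (deriv ^^ k) \<omega> 0 = 0) \<and> (deriv ^^ n) \<omega> 0 \<noteq> 0"

text \<open>The harmonic map f = h + conj g and the operators D f = z f_z - conj z f_{conj z},
  script-D f = z f_z + conj z f_{conj z}.\<close>
definition harm :: "(complex \<Rightarrow> complex) \<Rightarrow> (complex \<Rightarrow> complex) \<Rightarrow> complex \<Rightarrow> complex" where
  "harm h g z = h z + cnj (g z)"

definition Dop :: "(complex \<Rightarrow> complex) \<Rightarrow> (complex \<Rightarrow> complex) \<Rightarrow> complex \<Rightarrow> complex" where
  "Dop h g z = z * deriv h z - cnj z * cnj (deriv g z)"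

definition Dscr :: "(complex \<Rightarrow> complex) \<Rightarrow> (complex \<Rightarrow> complex) \<Rightarrow> complex \<Rightarrow> complex" where
  "Dscr h g z = z * deriv h z + cnj z * cnj (deriv g z)"

definition F3 :: "nat \<Rightarrow> nat \<Rightarrow> nat \<Rightarrow> nat \<Rightarrow> real \<Rightarrow> real" where
  "F3 s m p q r = r ^ (s * m) * (1 + r ^ m) ^ s / (1 - r ^ m) ^ (3 * s)
                  + (r ^ q / (1 - r ^ q) ^ 2) ^ p - 1"

definition r3 :: "nat \<Rightarrow> nat \<Rightarrow> nat \<Rightarrow> nat \<Rightarrow> real" where
  "r3 s m p q = (THE r. 0 < r \<and> r < 1 \<and> F3 s m p q r = 0)"

end

theory Submission
  imports Defs "HOL-Complex_Analysis.Complex_Analysis"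
begin

text \<open>If \<open>h + \<mu> cnj g\<close> is injective for all \<open>\<bar>\<mu>\<bar> = 1\<close>, then so is the holomorphic function \<open>h + \<lambda> g\<close> for all
  \<open>\<bar>\<lambda>\<bar> = 1\<close>: a coincidence of the latter at two points only says that the differences of \<open>h\<close> and \<open>g\<close>
  have equal modulus. Choosing \<open>\<lambda>\<close> to align arguments, the Koebe growth and distortion theorems bound
  \<open>\<bar>h\<bar> + \<bar>g\<bar>\<close> and \<open>\<bar>h'\<bar> + \<bar>g'\<bar>\<close>, and the Schwarz lemma bounds \<open>\<omega>\<close>. Equality holds for the Koebe
  function with \<open>g = 0\<close> and \<open>\<omega> z = z ^ n\<close>. Koebe's theorems rest on Bieberbach's inequality \<open>\<bar>a\<^sub>2\<bar> \<le> 2\<close>, which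
  comes from the area theorem: the area of the image of \<open>\<rho> \<le> \<bar>z\<bar> \<le> R\<close> under an injective
  \<open>G z = 1/z + b z + O(z\<^sup>2)\<close> is at least \<open>\<pi> (1/\<rho>\<^sup>2 - 1/R\<^sup>2) + \<pi> \<bar>b\<bar>\<^sup>2 (R\<^sup>2 - \<rho>\<^sup>2)\<close> by orthogonality of monomials,
  and at most \<open>\<pi> / \<rho>\<^sup>2 + o(1)\<close> because the image lies inside any convex set containing \<open>G\<close> of the circle
  \<open>\<bar>z\<bar> = \<rho>\<close>.\<close>

section \<open>Areas of holomorphic images\<close>

text \<open>The change of variables theorem is available for \<^typ>\<open>real^'n\<close> only, so areas are measured
  in \<^typ>\<open>real^2\<close> and transported through the following isometry.\<close>

definition cpx :: "real^2 \<Rightarrow> complex" where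
  "cpx v = Complex (v$1) (v$2)"

definition vc :: "complex \<Rightarrow> real^2" where
  "vc z = vector [Re z, Im z]"

lemma cpx_vc [simp]: "cpx (vc z) = z"
  by (simp add: cpx_def vc_def)

lemma vc_cpx [simp]: "vc (cpx v) = v"
  by (simp add: cpx_def vc_def vec_eq_iff forall_2)

lemma norm_cpx [simp]: "norm (cpx v) = norm v"
  by (simp add: cpx_def norm_vec_def L2_set_def sum_2 cmod_def)

lemma norm_vc [simp]: "norm (vc z) = norm z"
  by (metis cpx_vc norm_cpx)

lemma linear_cpx: "linear cpx"
  by (rule linearI) (auto simp: cpx_def complex_eq_iff)

lemma linear_vc: "linear vc"
  by (rule linearI) (auto simp: vc_def vec_eq_iff forall_2)

lemma bounded_linear_cpx: "bounded_linear cpx"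
  using linear_cpx linear_conv_bounded_linear by blast

lemma bounded_linear_vc: "bounded_linear vc"
  using linear_vc linear_conv_bounded_linear by blast

lemma inj_cpx: "inj cpx" by (metis injI vc_cpx)
lemma inj_vc: "inj vc" by (metis injI cpx_vc)

lemma has_derivative_vc_cpx:
  assumes "(f has_field_derivative d) (at (cpx v))"
  shows "((\<lambda>v. vc (f (cpx v))) has_derivative (\<lambda>h. vc (d * cpx h))) (at v within S)"
proof -
  have "((\<lambda>v. f (cpx v)) has_derivative (\<lambda>h. d * cpx h)) (at v)"
    using has_derivative_compose[OF bounded_linear_imp_has_derivative[OF bounded_linear_cpx]
      assms[unfolded has_field_derivative_def]] by (simp add: o_def)
  from has_derivative_compose[OF this bounded_linear_imp_has_derivative[OF bounded_linear_vc]]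
  show ?thesis by (simp add: has_derivative_at_withinI)
qed

text \<open>The Jacobian of the general real linear map of the plane in complex notation. The case
  \<open>b = 0\<close> is the derivative of a holomorphic map; \<open>a = 1\<close> is the map that
  turns discs into the ellipses of the upper area estimate.\<close>

lemma det_real_linear:
  "det (matrix (\<lambda>h. vc (a * cpx h + b * cnj (cpx h)))) = (norm a)\<^sup>2 - (norm b)\<^sup>2"
  unfolding det_2 matrix_def
  by (simp add: vc_def cpx_def axis_def cmod_def power2_eq_square algebra_simps)

lemma det_mult: "det (matrix (\<lambda>h. vc (d * cpx h))) = (norm d)\<^sup>2"
  using det_real_linear[of d 0] by simp

text \<open>Both directions of the equivalence are used: a known area of the image evaluates an
  integral, and a known integral yields measurability and area of the image.\<close>

lemma has_integral_area_image:
  assumes "S \<in> sets lebesgue"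
    and "\<And>v. v \<in> S \<Longrightarrow> (f has_field_derivative f' (cpx v)) (at (cpx v))"
    and "inj_on f (cpx ` S)"
  shows "(\<lambda>v. vc (f (cpx v))) ` S \<in> lmeasurable \<and> measure lebesgue ((\<lambda>v. vc (f (cpx v))) ` S) = m
     \<longleftrightarrow> ((\<lambda>v. (norm (f' (cpx v)))\<^sup>2) has_integral m) S"
proof -
  have "inj_on (\<lambda>v. vc (f (cpx v))) S"
    using assms(3) inj_cpx inj_vc by (auto simp: inj_on_def)
  from has_measure_differentiable_image[OF assms(1) has_derivative_vc_cpx[OF assms(2)] this, of m]
  show ?thesis by (simp add: det_mult)
qed

section \<open>Measure of annuli and rotation-invariant integrals over them\<close>

definition annul :: "real \<Rightarrow> real \<Rightarrow> (real^2) set" where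
  "annul \<rho> R = {v. \<rho> \<le> norm v \<and> norm v \<le> R}"

lemma annul_eq: "annul \<rho> R = cball 0 R - ball 0 \<rho>"
  by (auto simp: annul_def)

lemma compact_annul: "compact (annul \<rho> R)"
  by (simp add: annul_eq compact_diff)

lemma lmeasurable_annul: "annul \<rho> R \<in> lmeasurable"
  by (simp add: compact_annul lmeasurable_compact)

lemma measure_disc: "r \<ge> 0 \<Longrightarrow> measure lebesgue (cball (c::real^2) r) = pi * r\<^sup>2"
  by (simp add: content_cball unit_ball_vol_2)

lemma measure_annul:
  assumes "0 \<le> \<rho>" "\<rho> \<le> R"
  shows "measure lebesgue (annul \<rho> R) = pi * R\<^sup>2 - pi * \<rho>\<^sup>2"
proof -
  have "measure lebesgue (annul \<rho> R) = measure lebesgue (cball (0::real^2) R) - measure lebesgue (ball (0::real^2) \<rho>)"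
    unfolding annul_eq
    by (rule measurable_measure_Diff) (use assms in \<open>auto simp: \<close>)
  then show ?thesis using assms by (simp add: content_ball content_cball unit_ball_vol_2)
qed

lemma integrable_annul:
  fixes f :: "real^2 \<Rightarrow> real"
  assumes "continuous_on (annul \<rho> R) f"
  shows "f absolutely_integrable_on (annul \<rho> R)"
proof -
  have "integrable lborel (\<lambda>x. indicator (annul \<rho> R) x *\<^sub>R f x)"
    by (rule borel_integrable_compact[OF compact_annul assms])
  then show ?thesis
    unfolding set_integrable_def by (rule integrable_completion[THEN iffD2, rotated]) 
     (use borel_integrable_compact[OF compact_annul assms] in auto)
qed

lemma integral_rotate:
  fixes u :: "complex \<Rightarrow> real"
  assumes "continuous_on (cpx ` annul \<rho> R) u" "norm c = 1"
  shows "integral (annul \<rho> R) (\<lambda>v. u (c * cpx v)) = integral (annul \<rho> R) (\<lambda>v. u (cpx v))"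
proof -
  let ?g = "\<lambda>v. vc (c * cpx v)"
  have lin: "linear ?g"
    using linear_compose[OF linear_compose[OF linear_cpx linear_times[of c]] linear_vc] by (simp add: o_def)
  have cc: "c * (cnj c * w) = w" for w
    using assms(2) complex_norm_square[of c] by (simp add: mult.assoc[symmetric])
  have im: "?g ` annul \<rho> R = annul \<rho> R"
  proof -
    have "v \<in> ?g ` annul \<rho> R" if "v \<in> annul \<rho> R" for v
      by (rule image_eqI[of _ _ "vc (cnj c * cpx v)"])
        (use that assms in \<open>auto simp: annul_def norm_mult cc\<close>)
    then show ?thesis by (auto simp: annul_def norm_mult assms)
  qed
  have d: "\<bar>det (matrix ?g)\<bar> = 1" using assms det_mult[of c] by simp
  have cont: "continuous_on (annul \<rho> R) (\<lambda>v. u (cpx v))"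
    by (rule continuous_on_compose2[OF assms(1)])
       (auto intro: linear_continuous_on bounded_linear_cpx)
  \<comment> \<open>\<open>F\<close> is the integrand with values in \<open>real^1\<close>, the form
    in which the linear change of variables applies.\<close>
  define F :: "real^2 \<Rightarrow> real^1" where "F = (\<lambda>v. vec (u (cpx v)))"
  have "F absolutely_integrable_on annul \<rho> R"
    unfolding absolutely_integrable_on_1_iff using integrable_annul[OF cont] by (simp add: F_def)
  then have "integral (?g ` annul \<rho> R) F = \<bar>det (matrix ?g)\<bar> *\<^sub>R integral (annul \<rho> R) (F \<circ> ?g)"
    by (intro integral_change_of_variables_linear[OF lin]) (simp add: im)
  then show ?thesis
    by (simp add: im d integral_on_1_eq F_def o_def vec_eq_iff)
qed

section \<open>The area theorem\<close>

text \<open>Taylor polynomials approximate uniformly on smaller discs. The condition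
  \<open>c 0 = 0\<close> is kept because only monomials of positive degree integrate to zero over an
  annulus.\<close>

lemma holomorphic_uniform_poly:
  fixes f :: "complex \<Rightarrow> complex"
  assumes f: "f holomorphic_on ball 0 1" and f0: "f 0 = 0" and R: "0 \<le> R" "R < 1" and e: "e > 0"
  obtains c N where "c (0::nat) = 0" "\<And>z. norm z \<le> R \<Longrightarrow> norm (f z - (\<Sum>n<N. c n * z^n)) < e"
proof -
  define c where "c n = (deriv ^^ n) f 0 / fact n" for n
  have s: "(\<lambda>n. c n * z^n) sums f z" if "norm z < 1" for z
    using holomorphic_power_series[OF f, of z] that by (simp add: c_def)
  \<comment> \<open>Convergence at a radius strictly between \<open>R\<close> and 1 gives absolute
    convergence at \<open>R\<close>, hence the majorant for the Weierstrass test.\<close>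
  define S where "S = (R + 1) / 2"
  have S: "R < S" "S < 1" using R by (auto simp: S_def)
  have "summable (\<lambda>n. c n * (of_real S)^n)"
    using s[of "of_real S"] S R by (auto simp: sums_iff)
  then have sm: "summable (\<lambda>n. norm (c n * of_real R ^n))"
    by (rule powser_insidea) (use S R in auto)
  have "uniform_limit (cball 0 R) (\<lambda>n x. \<Sum>i<n. c i * x^i) (\<lambda>x. suminf (\<lambda>i. c i * x^i)) sequentially"
    by (rule Weierstrass_m_test[OF _ sm]) (use R in \<open>auto simp: norm_mult norm_power intro!: mult_left_mono power_mono\<close>)
  from uniform_limitD[OF this e] obtain N where
    N: "\<And>x. x \<in> cball 0 R \<Longrightarrow> dist (\<Sum>i<N. c i * x^i) (suminf (\<lambda>i. c i * x^i)) < e"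
    unfolding eventually_sequentially by blast
  show ?thesis
  proof (rule that[of c N])
    show "c 0 = 0" by (simp add: c_def f0)
    fix z :: complex assume z: "norm z \<le> R"
    then have "suminf (\<lambda>i. c i * z^i) = f z" using s[of z] R by (simp add: sums_iff)
    then show "norm (f z - (\<Sum>n<N. c n * z^n)) < e"
      using N[of z] z by (simp add: dist_norm norm_minus_commute)
  qed
qed

text \<open>The rotation by \<open>c\<close> preserves the integral and also reverses its
  sign.\<close>

lemma integral_annul_odd:
  fixes u :: "complex \<Rightarrow> real"
  assumes "continuous_on (cpx ` annul \<rho> R) u" "norm c = 1"
    and "\<And>z. \<rho> \<le> norm z \<Longrightarrow> norm z \<le> R \<Longrightarrow> u (c * z) = - u z"
  shows "integral (annul \<rho> R) (\<lambda>v. u (cpx v)) = 0"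
proof -
  have "integral (annul \<rho> R) (\<lambda>v. u (c * cpx v)) = integral (annul \<rho> R) (\<lambda>v. - u (cpx v))"
    by (rule integral_cong) (use assms(3) in \<open>auto simp: annul_def\<close>)
  with integral_rotate[OF assms(1,2)] show ?thesis by simp
qed

lemma continuous_on_annul_comp:
  fixes u :: "complex \<Rightarrow> 'a::topological_space"
  assumes "continuous_on {z. \<rho> \<le> norm z \<and> norm z \<le> R} u"
  shows "continuous_on (annul \<rho> R) (\<lambda>v. u (cpx v))" "continuous_on (cpx ` annul \<rho> R) u"
proof -
  have *: "cpx ` annul \<rho> R \<subseteq> {z. \<rho> \<le> norm z \<and> norm z \<le> R}" by (auto simp: annul_def)
  show "continuous_on (cpx ` annul \<rho> R) u" using assms * continuous_on_subset by blast
  then show "continuous_on (annul \<rho> R) (\<lambda>v. u (cpx v))"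
    by (rule continuous_on_compose2) (auto intro: linear_continuous_on bounded_linear_cpx)
qed

text \<open>A monomial of degree \<open>n > 0\<close> changes sign under the rotation by
  \<open>cis (pi / n)\<close>, while the radial weight is unchanged; the constant term is absent by
  \<open>c0\<close>.\<close>

lemma integral_annul_radial_poly:
  assumes w: "continuous_on {\<rho>..R} w" and c0: "c (0::nat) = (0::complex)"
  shows "integral (annul \<rho> R) (\<lambda>v. w (norm v) * Re (\<Sum>n<N. c n * cpx v ^ n)) = 0"
proof -
  have cw: "continuous_on {z::complex. \<rho> \<le> norm z \<and> norm z \<le> R} (\<lambda>z. w (norm z))"
    by (rule continuous_on_compose2[OF w]) (auto intro!: continuous_intros)
  have "integral (annul \<rho> R) (\<lambda>v. w (norm v) * Re (\<Sum>n<N. c n * cpx v ^ n)) =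
    integral (annul \<rho> R) (\<lambda>v. \<Sum>n<N. w (norm (cpx v)) * Re (c n * cpx v ^ n))"
    by (simp add: sum_distrib_left)
  also have "\<dots> = (\<Sum>n<N. integral (annul \<rho> R) (\<lambda>v. w (norm (cpx v)) * Re (c n * cpx v ^ n)))"
    by (intro integral_sum finite_lessThan set_lebesgue_integral_eq_integral(1) integrable_annul
       continuous_on_annul_comp(1)[of \<rho> R "\<lambda>z. w (norm z) * Re (c _ * z ^ _)"] continuous_intros cw)
  also have "\<dots> = (\<Sum>n<N. 0)"
  proof (rule sum.cong)
    fix n
    show "integral (annul \<rho> R) (\<lambda>v. w (norm (cpx v)) * Re (c n * cpx v ^ n)) = 0"
    proof (cases "n = 0")
      case False
      have "cis (pi / n) ^ n = -1" using False by (simp add: Complex.DeMoivre)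
      then show ?thesis
        by (intro integral_annul_odd[where c = "cis (pi / n)" and u = "\<lambda>z. w (norm z) * Re (c n * z ^ n)"]
              continuous_on_annul_comp(2) continuous_intros cw)
           (auto simp: norm_mult power_mult_distrib algebra_simps)
    qed (simp add: c0)
  qed simp
  finally show ?thesis by simp
qed

text \<open>A mean value property with radial weight: approximation by polynomials vanishing at 0
  changes the integral by at most \<open>e\<close> times the integral of the absolute
  weight.\<close>

lemma integral_annul_radial_holomorphic:
  assumes f: "f holomorphic_on ball 0 1" and f0: "f 0 = 0"
    and w: "continuous_on {\<rho>..R} w" and R: "0 \<le> R" "R < 1"
  shows "integral (annul \<rho> R) (\<lambda>v. w (norm v) * Re (f (cpx v))) = 0"
proof -
  let ?A = "annul \<rho> R"
  have cw: "continuous_on {z::complex. \<rho> \<le> norm z \<and> norm z \<le> R} (\<lambda>z. w (norm z))"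
    by (rule continuous_on_compose2[OF w]) (auto intro!: continuous_intros)
  have cf: "continuous_on {z::complex. \<rho> \<le> norm z \<and> norm z \<le> R} f"
    by (rule continuous_on_subset[OF holomorphic_on_imp_continuous_on[OF f]]) (use R in auto)
  let ?I = "integral ?A (\<lambda>v. w (norm v) * Re (f (cpx v)))"
  let ?W = "integral ?A (\<lambda>v. \<bar>w (norm v)\<bar>)"
  have cint: "(\<lambda>v. u (cpx v)) integrable_on ?A"
    if "continuous_on {z. \<rho> \<le> norm z \<and> norm z \<le> R} u" for u :: "complex \<Rightarrow> real"
    by (intro set_lebesgue_integral_eq_integral(1) integrable_annul continuous_on_annul_comp(1) that)
  have iw: "(\<lambda>v. \<bar>w (norm v)\<bar>) integrable_on ?A"
    using cint[OF continuous_on_rabs[OF cw]] by simp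
  have W0: "?W \<ge> 0" by (rule integral_nonneg[OF iw]) auto
  have *: "\<bar>?I\<bar> \<le> e * ?W" if e: "e > 0" for e
  proof -
    obtain c N where c0: "c (0::nat) = 0" and
      c: "\<And>z. norm z \<le> R \<Longrightarrow> norm (f z - (\<Sum>n<N. c n * z^n)) < e"
      using holomorphic_uniform_poly[OF f f0 R e] by blast
    let ?P = "\<lambda>z. \<Sum>n<N. c n * z^n"
    have iP: "(\<lambda>v. w (norm v) * Re (?P (cpx v))) integrable_on ?A"
      by (rule cint[of "\<lambda>z. w (norm z) * Re (?P z)", unfolded norm_cpx]) (intro continuous_intros cw)
    have iF: "(\<lambda>v. w (norm v) * Re (f (cpx v))) integrable_on ?A"
      by (rule cint[of "\<lambda>z. w (norm z) * Re (f z)", unfolded norm_cpx]) (intro continuous_intros cw cf)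
    have "?I = integral ?A (\<lambda>v. w (norm v) * Re (f (cpx v)) - w (norm v) * Re (?P (cpx v)))"
      using integral_diff[OF iF iP] integral_annul_radial_poly[where w = w and c = c, OF w c0] by simp
    moreover have "norm (integral ?A (\<lambda>v. w (norm v) * Re (f (cpx v)) - w (norm v) * Re (?P (cpx v))))
        \<le> integral ?A (\<lambda>v. e * \<bar>w (norm v)\<bar>)"
    proof (rule integral_norm_bound_integral)
      show "(\<lambda>v. w (norm v) * Re (f (cpx v)) - w (norm v) * Re (?P (cpx v))) integrable_on ?A"
        by (rule integrable_diff[OF iF iP])
      show "(\<lambda>v. e * \<bar>w (norm v)\<bar>) integrable_on ?A" using iw by (rule integrable_on_mult_right)
      fix v assume "v \<in> ?A"
      then have "norm (f (cpx v) - ?P (cpx v)) < e" by (intro c) (auto simp: annul_def)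
      then have "\<bar>Re (f (cpx v) - ?P (cpx v))\<bar> \<le> e" using abs_Re_le_cmod[of "f (cpx v) - ?P (cpx v)"] by linarith
      then have "\<bar>w (norm v)\<bar> * \<bar>Re (f (cpx v) - ?P (cpx v))\<bar> \<le> \<bar>w (norm v)\<bar> * e"
        by (rule mult_left_mono) auto
      then show "norm (w (norm v) * Re (f (cpx v)) - w (norm v) * Re (?P (cpx v))) \<le> e * \<bar>w (norm v)\<bar>"
        by (simp add: right_diff_distrib[symmetric] abs_mult mult.commute)
    qed
    ultimately show ?thesis by simp
  qed
  have "\<bar>?I\<bar> \<le> 0 + e" if "e > 0" for e
  proof -
    \<comment> \<open>The summand 1 keeps the denominator positive when the weight has integral
      0.\<close>
    have "\<bar>?I\<bar> \<le> (e / (?W + 1)) * ?W" by (rule *) (use W0 that in simp)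
    also have "\<dots> \<le> e" using W0 that by (simp add: field_simps)
    finally show ?thesis by simp
  qed
  then show ?thesis using field_le_epsilon[of "\<bar>?I\<bar>" 0] by simp
qed

text \<open>If a line separated an omitted point \<open>w0 = G z0\<close> from \<open>S\<close>, then \<open>1 / (G - w0)\<close> would be holomorphic
  on the disc of radius \<open>\<rho>\<close>, map its boundary into an open half plane with \<open>0\<close> on its edge, and vanish
  at the pole of \<open>G\<close>, against the maximum principle.\<close>
lemma convex_encloses_image:
  fixes h :: "complex \<Rightarrow> complex"
  assumes h: "h holomorphic_on ball 0 1"
    and inj: "inj_on (\<lambda>z. 1 / z + h z) (ball 0 1 - {0})"
    and S: "convex S" "closed S" and \<rho>: "0 < \<rho>" "\<rho> < norm z0" "norm z0 < 1"
    and sph: "\<And>z. norm z = \<rho> \<Longrightarrow> 1 / z + h z \<in> S"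
  shows "1 / z0 + h z0 \<in> S"
proof (rule ccontr)
  define w0 where "w0 = 1 / z0 + h z0"
  assume "1 / z0 + h z0 \<notin> S"
  then obtain a b where a: "inner a w0 < b" "\<And>x. x \<in> S \<Longrightarrow> inner a x > b"
    using separating_hyperplane_closed_point[OF S] unfolding w0_def by metis
  \<comment> \<open>Away from 0, \<open>d z\<close> is \<open>z\<close> times the difference of the
    map and \<open>w0\<close>, so \<open>P\<close> is \<open>a\<close> over that difference; written
    this way it extends holomorphically through the pole with \<open>P 0 = 0\<close>. By injectivity
    the value \<open>w0\<close> is taken only at \<open>z0\<close>, outside the closed disc, so
    \<open>d\<close> has no zero there.\<close>
  define d where "d z = 1 + z * (h z - w0)" for z
  define P where "P z = a * (z / d z)" for z
  have d: "d z \<noteq> 0" if "norm z \<le> \<rho>" for z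
  proof
    assume "d z = 0"
    then have "z \<noteq> 0" by (auto simp: d_def)
    then have "1 / z + h z = w0" using \<open>d z = 0\<close> by (simp add: d_def field_simps) 
    moreover have "z0 \<noteq> 0" using \<rho> by auto
    ultimately have "z = z0"
      using inj_onD[OF inj, of z z0] \<open>z \<noteq> 0\<close> that \<rho> by (simp add: w0_def)
    then show False using that \<rho> by simp
  qed
  have hold: "d holomorphic_on ball 0 1" unfolding d_def by (intro holomorphic_intros h)
  have holP: "P holomorphic_on ball 0 \<rho>" unfolding P_def
    using d \<rho> by (intro holomorphic_intros holomorphic_on_subset[OF hold]) auto
  have contP: "continuous_on (cball 0 \<rho>) P" unfolding P_def
    by (intro continuous_intros continuous_on_subset[OF holomorphic_on_imp_continuous_on[OF hold]])
       (use d \<rho> in auto)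
  \<comment> \<open>The real part of \<open>a / x\<close> has the sign of
    \<open>Re (a * cnj x)\<close>, which is \<open>inner a x\<close>, so the separating line gives
    positivity on the circle.\<close>
  have pos: "Re (P z) > 0" if z: "norm z = \<rho>" for z
  proof -
    define x where "x = 1 / z + h z - w0"
    have nz: "z \<noteq> 0" using z \<rho> by auto
    have "inner a x > 0" using a(1) a(2)[OF sph[OF z]] by (simp add: x_def inner_diff_right)
    then have "Re (a * cnj x) > 0" by (simp add: inner_complex_def)
    moreover have "x \<noteq> 0" using \<open>inner a x > 0\<close> by auto
    moreover have "P z = a / x"
    proof -
      have "d z = z * x" using nz by (simp add: d_def x_def field_simps)
      then show ?thesis using nz by (simp add: P_def)
    qed
    moreover have "Re (a / x) = Re (a * cnj x) / (norm x)\<^sup>2"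
      by (subst complex_div_cnj) (simp only: Re_divide_of_real of_real_power[symmetric])
    ultimately show ?thesis by simp
  qed
  \<comment> \<open>The modulus of \<open>exp (- P)\<close> is \<open>exp (- Re P)\<close>, which is
    below 1 on the circle and equals 1 at 0. Attaining the maximum over the circle at
    \<open>z1\<close> keeps the inequality strict.\<close>
  obtain z1 where z1: "z1 \<in> sphere 0 \<rho>" "\<And>z. z \<in> sphere 0 \<rho> \<Longrightarrow> norm (exp (- P z)) \<le> norm (exp (- P z1))"
  proof -
    have "continuous_on (sphere 0 \<rho>) (\<lambda>z. norm (exp (- P z)))"
      by (intro continuous_intros continuous_on_subset[OF contP]) auto
    from continuous_attains_sup[OF compact_sphere _ this] \<rho> that show ?thesis by fastforce
  qed
  have "norm (exp (- P 0)) \<le> norm (exp (- P z1))"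
  proof (rule maximum_modulus_frontier[where S = "ball 0 \<rho>" and f = "\<lambda>z. exp (- P z)"])
    show "(\<lambda>z. exp (- P z)) holomorphic_on interior (ball 0 \<rho>)"
      using holP by (auto intro!: holomorphic_intros)
    show "continuous_on (closure (ball 0 \<rho>)) (\<lambda>z. exp (- P z))"
      using contP \<rho> by (auto intro!: continuous_intros)
  qed (use z1 \<rho> in auto)
  moreover have "P 0 = 0" by (simp add: P_def)
  ultimately show False using pos[of z1] z1(1) by (simp add: norm_exp_eq_Re)
qed

text \<open>The integrand is the Jacobian of inversion, so the integral is the area of the inverted
  annulus with radii \<open>1/R\<close> and \<open>1/\<rho>\<close>.\<close>

lemma integral_inverse_fourth:
  assumes "0 < \<rho>" "\<rho> \<le> R"
  shows "integral (annul \<rho> R) (\<lambda>v. 1 / norm v ^ 4) = pi / \<rho>\<^sup>2 - pi / R\<^sup>2"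
proof -
  have im: "(\<lambda>v. vc (inverse (cpx v))) ` annul \<rho> R = annul (1/R) (1/\<rho>)" (is "?l = _")
  proof
    have "norm v > 0" if "v \<in> annul \<rho> R" for v
      using that assms by (auto simp: annul_def)
    then show "?l \<subseteq> annul (1/R) (1/\<rho>)"
      using assms by (force simp: annul_def norm_inverse norm_divide field_simps)
    have "v \<in> ?l" if "v \<in> annul (1/R) (1/\<rho>)" for v
    proof (rule image_eqI[of _ _ "vc (inverse (cpx v))"])
      have "0 < 1 / R" using assms by simp
      then have "norm v > 0" using that by (auto simp: annul_def intro: less_le_trans)
      then show "vc (inverse (cpx v)) \<in> annul \<rho> R"
        using that assms by (auto simp: annul_def norm_inverse norm_divide field_simps)
    qed simp
    then show "annul (1/R) (1/\<rho>) \<subseteq> ?l" by blast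
  qed
  have "((\<lambda>v. (norm (- (inverse (cpx v) * inverse (cpx v))))\<^sup>2) has_integral measure lebesgue ?l) (annul \<rho> R)"
  proof (rule has_integral_area_image[THEN iffD1])
    show "annul \<rho> R \<in> sets lebesgue" using lmeasurable_annul by blast
    fix v assume "v \<in> annul \<rho> R"
    then have "cpx v \<noteq> 0" using assms norm_cpx[of v] by (auto simp: annul_def simp del: norm_cpx)
    then show "(inverse has_field_derivative - (inverse (cpx v) * inverse (cpx v))) (at (cpx v))"
      using DERIV_inverse[of "cpx v" UNIV] by (simp add: power2_eq_square)
  qed (auto simp: im lmeasurable_annul inj_on_def)
  then have "((\<lambda>v. 1 / norm v ^ 4) has_integral measure lebesgue ?l) (annul \<rho> R)"
    by (rule has_integral_cong[THEN iffD1, rotated])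
       (simp add: norm_mult norm_inverse power2_eq_square power4_eq_xxxx divide_inverse)
  then have "((\<lambda>v. 1 / norm v ^ 4) has_integral measure lebesgue (annul (1/R) (1/\<rho>))) (annul \<rho> R)"
    unfolding im .
  then show ?thesis
    using assms by (simp add: measure_annul integral_unique frac_le power_divide)
qed

text \<open>In the expanded square all cross terms integrate to zero, and the remaining term
  \<open>(norm (K z))\<^sup>2\<close> is dropped, which gives an inequality.\<close>

lemma integral_derivative_lower:
  assumes K: "K holomorphic_on ball 0 1" "K 0 = 0" and r: "0 < \<rho>" "\<rho> \<le> R" "R < 1"
  shows "pi * (1 / \<rho>\<^sup>2 - 1 / R\<^sup>2) + (norm b)\<^sup>2 * pi * (R\<^sup>2 - \<rho>\<^sup>2)
    \<le> integral (annul \<rho> R) (\<lambda>v. (norm (- 1 / (cpx v)\<^sup>2 + b + K (cpx v)))\<^sup>2)"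
proof -
  let ?A = "annul \<rho> R"
  let ?D = "{z::complex. \<rho> \<le> norm z \<and> norm z \<le> R}"
  have cK: "continuous_on ?D K"
    by (rule continuous_on_subset[OF holomorphic_on_imp_continuous_on[OF K(1)]]) (use r in auto)
  have cint: "(\<lambda>v. u (cpx v)) integrable_on ?A"
    if "continuous_on ?D u" for u :: "complex \<Rightarrow> real"
    by (intro set_lebesgue_integral_eq_integral(1) integrable_annul continuous_on_annul_comp(1) that)
  have n0: "z \<noteq> 0" if "z \<in> ?D" for z using that r by auto
  \<comment> \<open>\<open>u1\<close> and \<open>u5\<close> are the squares of the first two
    summands, \<open>u2\<close>, \<open>u3\<close>, \<open>u4\<close> the cross terms. In
    \<open>u4\<close> the conjugate of \<open>1 / z\<^sup>2\<close> is rewritten as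
    \<open>z\<^sup>2 / norm z ^ 4\<close>, which leaves a radial weight times the real part of a
    holomorphic function vanishing at 0.\<close>
  define u1 :: "complex \<Rightarrow> real" where "u1 = (\<lambda>z. 1 / norm z ^ 4)"
  define u2 where "u2 = (\<lambda>z. - 2 * Re (cnj b / z\<^sup>2))"
  define u3 where "u3 = (\<lambda>z. 2 * Re (cnj b * K z))"
  define u4 where "u4 = (\<lambda>z::complex. (- 2 / norm z ^ 4) * Re (z\<^sup>2 * K z))"
  define u5 :: "complex \<Rightarrow> real" where "u5 = (\<lambda>z. (norm b)\<^sup>2)"
  have c: "continuous_on ?D u1" "continuous_on ?D u2" "continuous_on ?D u3" "continuous_on ?D u4"
    "continuous_on ?D u5"
    unfolding u1_def u2_def u3_def u4_def u5_def
    by (intro continuous_intros cK; use n0 in auto)+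
  note i = c[THEN cint]
  have I1: "integral ?A (\<lambda>v. u1 (cpx v)) = pi / \<rho>\<^sup>2 - pi / R\<^sup>2"
    using integral_inverse_fourth[of \<rho> R] r by (simp add: u1_def)
  have I2: "integral ?A (\<lambda>v. u2 (cpx v)) = 0"
    by (rule integral_annul_odd[OF continuous_on_annul_comp(2)[OF c(2)], of \<i>])
       (auto simp: u2_def power_mult_distrib)
  have I3: "integral ?A (\<lambda>v. u3 (cpx v)) = 0"
    unfolding u3_def
    by (rule integral_annul_radial_holomorphic[of "\<lambda>z. cnj b * K z" \<rho> R "\<lambda>_. 2"])
       (use K r in \<open>auto intro!: holomorphic_intros\<close>)
  have I4: "integral ?A (\<lambda>v. u4 (cpx v)) = 0"
    unfolding u4_def norm_cpx
    by (rule integral_annul_radial_holomorphic[of "\<lambda>z. z\<^sup>2 * K z" \<rho> R "\<lambda>x. - 2 / x ^ 4"])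
       (use K r in \<open>auto intro!: holomorphic_intros continuous_intros\<close>)
  have I5: "integral ?A (\<lambda>v. u5 (cpx v)) = (norm b)\<^sup>2 * (pi * R\<^sup>2 - pi * \<rho>\<^sup>2)"
    using measure_annul[of \<rho> R] r lmeasurable_annul[of \<rho> R]
      integral_mult_right[of ?A "(norm b)\<^sup>2" "\<lambda>_. 1::real"]
    by (simp add: u5_def lmeasure_integral)
  have "integral ?A (\<lambda>v. u1 (cpx v) + u2 (cpx v) + u3 (cpx v) + u4 (cpx v) + u5 (cpx v)) =
     pi / \<rho>\<^sup>2 - pi / R\<^sup>2 + (norm b)\<^sup>2 * (pi * R\<^sup>2 - pi * \<rho>\<^sup>2)"
    using i by (simp add: integral_add integrable_add I1 I2 I3 I4 I5)
  also have "\<dots> = pi * (1 / \<rho>\<^sup>2 - 1 / R\<^sup>2) + (norm b)\<^sup>2 * pi * (R\<^sup>2 - \<rho>\<^sup>2)"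
    by (simp add: algebra_simps)
  finally have eq: "integral ?A (\<lambda>v. u1 (cpx v) + u2 (cpx v) + u3 (cpx v) + u4 (cpx v) + u5 (cpx v)) = \<dots>" .
  have le: "u1 z + u2 z + u3 z + u4 z + u5 z \<le> (norm (- 1 / z\<^sup>2 + b + K z))\<^sup>2" if "z \<in> ?D" for z
  proof -
    define y where "y = 1 / z\<^sup>2"
    have z: "z \<noteq> 0" by (rule n0[OF that])
    have ny: "(norm y)\<^sup>2 = u1 z" by (simp add: y_def u1_def norm_divide norm_power power_divide)
    have cy: "cnj y = (z\<^sup>2) * of_real (u1 z)"
      using z ny complex_norm_square[of y] unfolding y_def 
      by (simp add: field_simps)
    have "u4 z = - 2 * Re (cnj y * K z)"
      unfolding cy by (simp add: u4_def u1_def mult.assoc mult.left_commute[of "z\<^sup>2"] diff_divide_distrib)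
    moreover have "u2 z = - 2 * Re (cnj b * y)" by (simp add: u2_def y_def)
    moreover have "(norm (- y + b + K z))\<^sup>2 = (norm y)\<^sup>2 + (norm b)\<^sup>2 + (norm (K z))\<^sup>2
       - 2 * Re (cnj b * y) + 2 * Re (cnj b * K z) - 2 * Re (cnj y * K z)"
      unfolding cmod_power2 by (simp add: power2_eq_square algebra_simps)
    ultimately show ?thesis using ny by (simp add: u3_def u5_def y_def)
  qed
  show ?thesis unfolding eq[symmetric]
  proof (rule integral_le)
    show "(\<lambda>v. u1 (cpx v) + u2 (cpx v) + u3 (cpx v) + u4 (cpx v) + u5 (cpx v)) integrable_on ?A"
      using i by (simp add: integrable_add)
    have "continuous_on ?D (\<lambda>z. (norm (- 1 / z\<^sup>2 + b + K z))\<^sup>2)"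
      by (intro continuous_intros cK) (use n0 in auto)
    from cint[OF this] show "(\<lambda>v. (norm (- 1 / (cpx v)\<^sup>2 + b + K (cpx v)))\<^sup>2) integrable_on ?A" .
  qed (use le in \<open>auto simp: annul_def\<close>)
qed

section \<open>Upper estimate of the area by an enclosing ellipse\<close>

lemma linear_cpx_conj: "linear (\<lambda>z. z + \<beta> * cnj z)"
  by (rule linearI) (auto simp: algebra_simps)

text \<open>On \<open>\<bar>z\<bar> = \<rho>\<close> one has \<open>z = \<rho>\<^sup>2 cnj (1/z)\<close>, so \<open>G\<close> is there the real linear map
  \<open>T w = w + b \<rho>\<^sup>2 cnj w\<close> at \<open>w = 1/z\<close>, up to an error of size \<open>O(\<rho>\<^sup>2)\<close>. Enclosing the image by an ellipse
  rather than by a disc is what makes the excess of area over \<open>\<pi> / \<rho>\<^sup>2\<close> tend to \<open>0\<close>.\<close>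
lemma area_image_upper:
  fixes k :: "complex \<Rightarrow> complex" and b :: complex
  defines "G \<equiv> \<lambda>z. 1 / z + (b * z + z\<^sup>2 * k z)"
  assumes k: "k holomorphic_on ball 0 1"
    and inj: "inj_on G (ball 0 1 - {0})"
    and r: "0 < \<rho>" "\<rho> < R" "R < 1" and b: "norm b * \<rho>\<^sup>2 \<le> 1/2"
    and M: "\<And>z. norm z = \<rho> \<Longrightarrow> norm (k z) \<le> M"
    and meas: "(\<lambda>v. vc (G (cpx v))) ` annul \<rho> R \<in> lmeasurable"
  shows "measure lebesgue ((\<lambda>v. vc (G (cpx v))) ` annul \<rho> R) \<le> pi * (1 / \<rho> + 2 * M * \<rho>\<^sup>2)\<^sup>2"
proof -
  define \<beta> where "\<beta> = b * of_real (\<rho>\<^sup>2)"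
  define T where "T z = z + \<beta> * cnj z" for z
  define s where "s = 1 / \<rho> + 2 * M * \<rho>\<^sup>2"
  have n\<beta>: "norm \<beta> \<le> 1/2" using b by (simp add: \<beta>_def norm_mult norm_power)
  have linT: "linear T" unfolding T_def by (rule linear_cpx_conj)
  have "M \<ge> 0" using M[of "of_real \<rho>"] r by (smt (verit) norm_ge_zero norm_of_real)
  then have s0: "s \<ge> 0" using r by (simp add: s_def)
  have cv: "convex (T ` cball 0 s)" "closed (T ` cball 0 s)"
    using linT by (auto intro!: convex_linear_image compact_imp_closed compact_continuous_image
        linear_continuous_on simp: linear_conv_bounded_linear)
  have sph: "G z \<in> T ` cball 0 s" if z: "norm z = \<rho>" for z
  proof -
    define e where "e = z\<^sup>2 * k z"
    \<comment> \<open>This solves \<open>T d = e\<close> for the remainder \<open>e\<close>, so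
      \<open>G z = T (1/z + d)\<close>. Since \<open>norm \<beta>\<close> is at most 1/2, the
      solution satisfies \<open>norm d \<le> 2 * norm e\<close>, whence the constant 2 in
      \<open>s\<close>.\<close>
    define d where "d = (e - \<beta> * cnj e) / of_real (1 - (norm \<beta>)\<^sup>2)"
    have "norm \<beta> < 1" using n\<beta> by simp
    then have q1: "(norm \<beta>)\<^sup>2 < 1" by (simp add: power_less_one_iff abs_square_less_1)
    have nz: "1 - \<beta> * cnj \<beta> \<noteq> 0"
      using q1 complex_norm_square[of \<beta>] by (metis less_irrefl of_real_eq_1_iff right_minus_eq)
    have Td: "T d = e"
    proof -
      define D where "D = 1 - \<beta> * cnj \<beta>"
      have d: "d = (e - \<beta> * cnj e) / D" by (simp add: d_def D_def complex_norm_square[symmetric])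
      have "cnj D = D" by (simp add: D_def mult.commute)
      then have "T d = ((e - \<beta> * cnj e) + \<beta> * (cnj e - cnj \<beta> * e)) / D"
        by (simp add: T_def d add_divide_distrib)
      also have "(e - \<beta> * cnj e) + \<beta> * (cnj e - cnj \<beta> * e) = D * e"
        by (simp add: D_def algebra_simps)
      finally show ?thesis using nz by (simp add: D_def)
    qed
    have Tw: "T (1 / z) = 1 / z + b * z"
    proof -
      have "z \<noteq> 0" using z r by auto
      moreover have "of_real (\<rho>\<^sup>2) = z * cnj z" using complex_norm_square[of z] z by simp
      ultimately show ?thesis by (simp add: T_def \<beta>_def)
    qed
    have "norm e \<le> \<rho>\<^sup>2 * M" unfolding e_def norm_mult norm_power z by (intro mult_left_mono M z) auto
    have "norm d = norm (e - \<beta> * cnj e) / (1 - (norm \<beta>)\<^sup>2)"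
      using q1 by (simp add: d_def norm_divide del: of_real_diff of_real_power)
    also have "\<dots> \<le> (norm e + norm \<beta> * norm e) / (1 - (norm \<beta>)\<^sup>2)"
      by (intro divide_right_mono order_trans[OF norm_triangle_ineq4]) (use q1 in \<open>auto simp: norm_mult\<close>)
    also have "\<dots> = norm e / (1 - norm \<beta>)"
      using \<open>norm \<beta> < 1\<close> q1 by (simp add: field_simps power2_eq_square)
    also have "\<dots> \<le> norm e / (1/2)" by (rule divide_left_mono) (use n\<beta> in auto)
    also have "\<dots> \<le> 2 * M * \<rho>\<^sup>2" using \<open>norm e \<le> \<rho>\<^sup>2 * M\<close> by (simp add: mult.commute)
    finally have "norm d \<le> 2 * M * \<rho>\<^sup>2" .
    then have "norm (1 / z + d) \<le> s" using norm_triangle_ineq[of "1/z" d] z by (simp add: s_def norm_divide)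
    moreover have "G z = T (1 / z + d)" by (simp add: linear_add[OF linT] Td Tw G_def e_def)
    ultimately show ?thesis by auto
  qed
  have inside: "G z \<in> T ` cball 0 s" if "\<rho> \<le> norm z" "norm z \<le> R" for z
  proof (cases "norm z = \<rho>")
    case False
    have "1 / z + (b * z + z\<^sup>2 * k z) \<in> T ` cball 0 s"
    proof (rule convex_encloses_image)
      show "(\<lambda>z. b * z + z\<^sup>2 * k z) holomorphic_on ball 0 1" by (intro holomorphic_intros k)
    qed (use inj cv sph False that r in \<open>auto simp: G_def\<close>)
    then show ?thesis by (simp add: G_def)
  qed (simp add: sph)
  let ?T = "\<lambda>v. vc (1 * cpx v + \<beta> * cnj (cpx v))"
  have linT': "linear ?T"
    using linear_compose[OF linear_compose[OF linear_cpx linear_cpx_conj[of \<beta>]] linear_vc] by (simp add: o_def)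
  have sub: "(\<lambda>v. vc (G (cpx v))) ` annul \<rho> R \<subseteq> ?T ` cball 0 s"
  proof clarify
    fix v assume "v \<in> annul \<rho> R"
    then obtain d where "norm d \<le> s" "G (cpx v) = T d" using inside[of "cpx v"] by (auto simp: annul_def)
    then show "vc (G (cpx v)) \<in> ?T ` cball 0 s"
      by (intro image_eqI[of _ _ "vc d"]) (auto simp: T_def)
  qed
  have "measure lebesgue ((\<lambda>v. vc (G (cpx v))) ` annul \<rho> R) \<le> measure lebesgue (?T ` cball 0 s)"
    by (rule measure_mono_fmeasurable[OF sub])
       (use meas measurable_linear_image[OF linT'] in auto)
  also have "\<dots> = \<bar>det (matrix ?T)\<bar> * (pi * s\<^sup>2)"
    using measure_linear_image[OF linT', of "cball 0 s"] measure_disc[OF s0] by simp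
  \<comment> \<open>The Jacobian of \<open>T\<close> is 1 minus the square of
    \<open>norm \<beta>\<close>, so the ellipse has no more area than the disc.\<close>
  also have "\<dots> \<le> 1 * (pi * s\<^sup>2)"
  proof (rule mult_right_mono)
    have "(norm \<beta>)\<^sup>2 \<le> 1" using n\<beta> by (simp add: power_le_one)
    then show "\<bar>det (matrix ?T)\<bar> \<le> 1" unfolding det_real_linear by simp
  qed simp
  finally show ?thesis by (simp add: s_def)
qed

text \<open>The two estimates of the area are compared as \<rho> tends to 0, where their leading
  terms \<open>1 / \<rho>\<^sup>2\<close> cancel, and then as \<open>R\<close> tends to 1.\<close>

theorem area_theorem_first_coeff:
  fixes k :: "complex \<Rightarrow> complex" and b :: complex
  assumes k: "k holomorphic_on ball 0 1"
    and inj: "inj_on (\<lambda>z. 1 / z + (b * z + z\<^sup>2 * k z)) (ball 0 1 - {0})"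
  shows "norm b \<le> 1"
proof -
  \<comment> \<open>\<open>K\<close> is the derivative of \<open>z\<^sup>2 * k z\<close>; it
    vanishes at 0 as the lower estimate requires.\<close>
  define K where "K = (\<lambda>z. 2 * z * k z + z\<^sup>2 * deriv k z)"
  have holK: "K holomorphic_on ball 0 1" unfolding K_def
    by (intro holomorphic_intros k holomorphic_deriv) auto
  \<comment> \<open>One bound on the disc of radius 1/2 serves all small \<rho> at once, so the
    error terms vanish in the limit.\<close>
  obtain M where M: "\<And>z. norm z \<le> 1/2 \<Longrightarrow> norm (k z) \<le> M"
  proof -
    have "compact (k ` cball 0 (1/2))"
      by (intro compact_continuous_image continuous_on_subset[OF holomorphic_on_imp_continuous_on[OF k]]) auto
    then have "bounded (k ` cball 0 (1/2))" by (rule compact_imp_bounded)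
    with that show ?thesis by (fastforce simp: bounded_iff)
  qed
  have main: "1 / \<rho>\<^sup>2 - 1 / R\<^sup>2 + (norm b)\<^sup>2 * (R\<^sup>2 - \<rho>\<^sup>2) \<le> (1 / \<rho> + 2 * M * \<rho>\<^sup>2)\<^sup>2"
    if r: "0 < \<rho>" "\<rho> < R" "R < 1" and \<rho>: "norm b * \<rho>\<^sup>2 \<le> 1/2" "\<rho> \<le> 1/2" for \<rho> R
  proof -
    let ?A = "annul \<rho> R"
    let ?G = "\<lambda>z. 1 / z + (b * z + z\<^sup>2 * k z)"
    let ?G' = "\<lambda>z. - 1 / z\<^sup>2 + b + K z"
    have ne: "cpx v \<noteq> 0 \<and> cpx v \<in> ball 0 1" if "v \<in> ?A" for v
      using that r norm_cpx[of v] by (auto simp: annul_def simp del: norm_cpx)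
    have der: "(?G has_field_derivative ?G' z) (at z)" if "z \<noteq> 0" "z \<in> ball 0 1" for z
    proof -
      have "(k has_field_derivative deriv k z) (at z)"
        using holomorphic_derivI[OF k open_ball that(2)] .
      then show ?thesis using that(1)
        by (auto intro!: derivative_eq_intros simp: K_def power2_eq_square)
    qed
    let ?I = "integral ?A (\<lambda>v. (norm (?G' (cpx v)))\<^sup>2)"
    have "continuous_on {z. \<rho> \<le> norm z \<and> norm z \<le> R} (\<lambda>z. (norm (?G' z))\<^sup>2)"
      by (intro continuous_intros continuous_on_subset[OF holomorphic_on_imp_continuous_on[OF holK]])
         (use r in auto)
    then have "(\<lambda>v. (norm (?G' (cpx v)))\<^sup>2) integrable_on ?A"
      by (intro set_lebesgue_integral_eq_integral(1) integrable_annul continuous_on_annul_comp(1))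
    then have hi: "((\<lambda>v. (norm (?G' (cpx v)))\<^sup>2) has_integral ?I) ?A" by (rule integrable_integral)
    have "(\<lambda>v. vc (?G (cpx v))) ` ?A \<in> lmeasurable \<and> measure lebesgue ((\<lambda>v. vc (?G (cpx v))) ` ?A) = ?I"
    proof (rule has_integral_area_image[THEN iffD2, OF _ _ _ hi])
      show "inj_on ?G (cpx ` ?A)" by (rule inj_on_subset[OF inj]) (use ne in auto)
    qed (use der ne lmeasurable_annul in auto)
    with area_image_upper[OF k inj r \<rho>(1), of M] M \<rho>(2)
    have "?I \<le> pi * (1 / \<rho> + 2 * M * \<rho>\<^sup>2)\<^sup>2" by simp
    moreover have "pi * (1 / \<rho>\<^sup>2 - 1 / R\<^sup>2) + (norm b)\<^sup>2 * pi * (R\<^sup>2 - \<rho>\<^sup>2) \<le> ?I"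
      by (rule integral_derivative_lower[OF holK]) (use r in \<open>auto simp: K_def\<close>)
    ultimately have "pi * (1 / \<rho>\<^sup>2 - 1 / R\<^sup>2 + (norm b)\<^sup>2 * (R\<^sup>2 - \<rho>\<^sup>2)) \<le> pi * (1 / \<rho> + 2 * M * \<rho>\<^sup>2)\<^sup>2"
      by (simp add: algebra_simps)
    then show ?thesis by simp
  qed
  have R: "(norm b)\<^sup>2 * R\<^sup>2 \<le> 1 / R\<^sup>2" if R: "0 < R" "R < 1" for R
  proof -
    have lim: "((\<lambda>\<rho>. (norm b)\<^sup>2 * (R\<^sup>2 - \<rho>\<^sup>2) - 1 / R\<^sup>2 - (4 * M * \<rho> + 4 * M\<^sup>2 * \<rho> ^ 4)) \<longlongrightarrow>
      (norm b)\<^sup>2 * (R\<^sup>2 - 0\<^sup>2) - 1 / R\<^sup>2 - (4 * M * 0 + 4 * M\<^sup>2 * 0 ^ 4)) (at_right 0)"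
      by (intro tendsto_intros)
    have "\<forall>\<^sub>F \<rho> in at_right 0. norm b * \<rho>\<^sup>2 < 1/2"
    proof (rule order_tendstoD(2))
      show "((\<lambda>\<rho>. norm b * \<rho>\<^sup>2) \<longlongrightarrow> norm b * 0\<^sup>2) (at_right 0)" by (intro tendsto_intros)
    qed simp
    moreover have "\<forall>\<^sub>F \<rho> in at_right 0. \<rho> \<in> {0<..<min R (1/2)}"
      by (rule eventually_at_right_real) (use R in auto)
    ultimately have "\<forall>\<^sub>F \<rho> in at_right 0. (norm b)\<^sup>2 * (R\<^sup>2 - \<rho>\<^sup>2) - 1 / R\<^sup>2 - (4 * M * \<rho> + 4 * M\<^sup>2 * \<rho> ^ 4) \<le> 0"
    proof eventually_elim
      case (elim \<rho>)
      then have "1 / \<rho>\<^sup>2 - 1 / R\<^sup>2 + (norm b)\<^sup>2 * (R\<^sup>2 - \<rho>\<^sup>2) \<le> (1 / \<rho> + 2 * M * \<rho>\<^sup>2)\<^sup>2"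
        by (intro main) (use R in auto)
      moreover have "(1 / \<rho> + 2 * M * \<rho>\<^sup>2)\<^sup>2 = 1 / \<rho>\<^sup>2 + (4 * M * \<rho> + 4 * M\<^sup>2 * \<rho> ^ 4)"
        using elim by (simp add: field_simps power2_eq_square power4_eq_xxxx)
      ultimately show ?case by simp
    qed
    from tendsto_upperbound[OF lim this] show ?thesis by simp
  qed
  have "(norm b)\<^sup>2 * 1\<^sup>2 \<le> 1 / 1\<^sup>2"
  proof (rule tendsto_le[of "at_left (1::real)"])
    show "((\<lambda>R. 1 / R\<^sup>2) \<longlongrightarrow> 1 / 1\<^sup>2) (at_left (1::real))" by (intro tendsto_intros) auto
    show "((\<lambda>R. (norm b)\<^sup>2 * R\<^sup>2) \<longlongrightarrow> (norm b)\<^sup>2 * 1\<^sup>2) (at_left (1::real))" by (intro tendsto_intros)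
    have "\<forall>\<^sub>F R in at_left 1. R \<in> {0<..<1::real}" by (rule eventually_at_left_real) auto
    then show "\<forall>\<^sub>F R in at_left 1. (norm b)\<^sup>2 * R\<^sup>2 \<le> 1 / R\<^sup>2"
      by eventually_elim (use R in auto)
  qed auto
  then show ?thesis by (simp add: abs_square_le_1)
qed

section \<open>Bieberbach's inequality and Koebe's theorems\<close>

text \<open>The quotient has a removable singularity at 0, filled by the derivative. Away from 0 it
  is the quotient itself, so the identity holds for every \<open>z\<close>.\<close>

lemma holomorphic_divided_difference:
  assumes "f holomorphic_on ball 0 1"
  obtains g where "g holomorphic_on ball 0 1" "\<And>z. f z = f 0 + z * g z" "g 0 = deriv f 0"
proof
  let ?g = "\<lambda>z. if z = 0 then deriv f 0 else (f z - f 0) / (z - 0)"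
  show "?g holomorphic_on ball 0 1" by (rule pole_lemma_open[OF assms open_ball])
qed auto

lemma deriv_deriv_mult_id:
  assumes g: "g holomorphic_on ball 0 1" and f: "\<And>z. z \<in> ball 0 1 \<Longrightarrow> f z = z * g z"
  shows "deriv (deriv f) 0 = 2 * deriv g 0"
proof -
  have der: "(f has_field_derivative g z + z * deriv g z) (at z)" if "z \<in> ball 0 1" for z
  proof (rule has_field_derivative_transform_within_open[where S = "ball 0 1"])
    show "((\<lambda>z. z * g z) has_field_derivative g z + z * deriv g z) (at z)"
      by (auto intro!: derivative_eq_intros holomorphic_derivI[OF g open_ball that])
  qed (use f that in auto)
  have g': "deriv g holomorphic_on ball 0 1" by (rule holomorphic_deriv[OF g open_ball])
  have "((\<lambda>z. g z + z * deriv g z) has_field_derivative 2 * deriv g 0) (at 0)"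
    by (auto intro!: derivative_eq_intros holomorphic_derivI[OF g open_ball]
        holomorphic_derivI[OF g' open_ball])
  then have "(deriv f has_field_derivative 2 * deriv g 0) (at 0)"
    by (rule has_field_derivative_transform_within_open[where S = "ball 0 1"])
       (use der[THEN DERIV_imp_deriv] in auto)
  then show "deriv (deriv f) 0 = 2 * deriv g 0" by (rule DERIV_imp_deriv)
qed

text \<open>The area theorem is applied to \<open>\<psi> (z\<^sup>2) / z\<close>, a branch of the
  reciprocal square root of \<open>F (z\<^sup>2)\<close>. Its coefficient of \<open>z\<close> is
  minus half the second coefficient of \<open>F\<close>.\<close>

theorem bieberbach_second_coeff:
  assumes F: "F holomorphic_on ball 0 1" and inj: "inj_on F (ball 0 1)"
    and F0: "F 0 = 0" "deriv F 0 = 1"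
  shows "norm (deriv (deriv F) 0) \<le> 4"
proof -
  obtain \<phi> where \<phi>: "\<phi> holomorphic_on ball 0 1" "\<And>z. F z = z * \<phi> z" "\<phi> 0 = 1"
    using holomorphic_divided_difference[OF F] F0 by auto
  have \<phi>nz: "\<phi> z \<noteq> 0" if "z \<in> ball 0 1" for z
  proof
    assume "\<phi> z = 0"
    then have "F z = F 0" using \<phi>(2)[of z] F0 by simp
    then have "z = 0" using inj_onD[OF inj, of z 0] that by simp
    then show False using \<open>\<phi> z = 0\<close> \<phi>(3) by simp
  qed
  obtain \<sigma> where \<sigma>: "\<sigma> holomorphic_on ball 0 1" "\<And>z. z \<in> ball 0 1 \<Longrightarrow> \<phi> z = (\<sigma> z)\<^sup>2"
    using contractible_imp_holomorphic_sqrt[OF \<phi>(1)] \<phi>nz convex_imp_contractible convex_ball by metis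
  have \<sigma>nz: "\<sigma> z \<noteq> 0" if "z \<in> ball 0 1" for z using \<sigma>(2) \<phi>nz that by fastforce
  \<comment> \<open>Since \<open>\<sigma> 0\<close> is 1 or -1, this factor normalises
    \<open>\<psi> 0 = 1\<close> whichever branch of the root was obtained.\<close>
  define \<psi> where "\<psi> z = \<sigma> 0 / \<sigma> z" for z
  have \<psi>: "\<psi> holomorphic_on ball 0 1"
    unfolding \<psi>_def using \<sigma>nz by (intro holomorphic_intros \<sigma>) auto
  have \<psi>0: "\<psi> 0 = 1" using \<sigma>nz by (simp add: \<psi>_def)
  have \<sigma>0: "(\<sigma> 0)\<^sup>2 = 1" using \<sigma>(2)[of 0] \<phi>(3) by simp
  have \<psi>\<phi>: "(\<psi> z)\<^sup>2 * \<phi> z = 1" if "z \<in> ball 0 1" for z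
    using \<sigma>(2)[OF that] \<sigma>nz[OF that] \<sigma>0 by (simp add: \<psi>_def power_divide)
  have "((\<lambda>z. (\<psi> z)\<^sup>2 * \<phi> z) has_field_derivative 2 * deriv \<psi> 0 + deriv \<phi> 0) (at 0)"
    by (auto intro!: derivative_eq_intros holomorphic_derivI[OF \<psi> open_ball]
        holomorphic_derivI[OF \<phi>(1) open_ball] simp: \<psi>0 \<phi>(3))
  moreover have "((\<lambda>z. (\<psi> z)\<^sup>2 * \<phi> z) has_field_derivative 0) (at 0)"
    by (rule has_field_derivative_transform_within_open[where S = "ball 0 1" and f = "\<lambda>_. 1"]) (auto simp: \<psi>\<phi>)
  ultimately have d: "2 * deriv \<psi> 0 + deriv \<phi> 0 = 0" by (rule DERIV_unique)
  \<comment> \<open>Dividing twice exhibits the terms of \<open>\<psi>\<close> up to first order,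
    which brings \<open>\<psi> (z\<^sup>2) / z\<close> into the shape of the area theorem.\<close>
  obtain \<eta> where \<eta>: "\<eta> holomorphic_on ball 0 1" "\<And>z. \<psi> z = 1 + z * \<eta> z" "\<eta> 0 = deriv \<psi> 0"
    using holomorphic_divided_difference[OF \<psi>] \<psi>0 by auto
  obtain \<kappa> where \<kappa>: "\<kappa> holomorphic_on ball 0 1" "\<And>z. \<eta> z = deriv \<psi> 0 + z * \<kappa> z"
    using holomorphic_divided_difference[OF \<eta>(1)] \<eta>(3) by auto
  have sq: "z\<^sup>2 \<in> ball 0 1" if "z \<in> ball 0 1" for z :: complex
    using that by (simp add: norm_power power_less_one_iff)
  have "norm (deriv \<psi> 0) \<le> 1"
  proof (rule area_theorem_first_coeff)
    show "(\<lambda>z. z * \<kappa> (z\<^sup>2)) holomorphic_on ball 0 1"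
      using sq by (intro holomorphic_intros holomorphic_on_compose_gen[OF _ \<kappa>(1), unfolded o_def]) auto
    have G: "1 / z + (deriv \<psi> 0 * z + z\<^sup>2 * (z * \<kappa> (z\<^sup>2))) = \<psi> (z\<^sup>2) / z" if "z \<noteq> 0" for z
      using that by (simp add: \<eta>(2) \<kappa>(2) field_simps power2_eq_square)
    \<comment> \<open>Squaring a coincidence gives \<open>F (x\<^sup>2) = F (y\<^sup>2)\<close>,
      hence \<open>y = x\<close> or \<open>y = - x\<close>; the map is odd without zeros, so the
      latter is impossible.\<close>
    have "inj_on (\<lambda>z. \<psi> (z\<^sup>2) / z) (ball 0 1 - {0})"
    proof (rule inj_onI)
      fix x y :: complex
      assume x: "x \<in> ball 0 1 - {0}" and y: "y \<in> ball 0 1 - {0}" and e: "\<psi> (x\<^sup>2) / x = \<psi> (y\<^sup>2) / y"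
      have FG: "(\<psi> (z\<^sup>2) / z)\<^sup>2 * F (z\<^sup>2) = 1" if "z \<in> ball 0 1 - {0}" for z
        using \<psi>\<phi>[OF sq, of z] that by (simp add: \<phi>(2) power_divide)
      have "(\<psi> (y\<^sup>2) / y)\<^sup>2 * F (x\<^sup>2) = (\<psi> (y\<^sup>2) / y)\<^sup>2 * F (y\<^sup>2)"
        using FG[OF x] FG[OF y] e by simp
      then have "F (x\<^sup>2) = F (y\<^sup>2)" using FG[OF y] by (metis mult_left_cancel mult_zero_left zero_neq_one)
      then have "x\<^sup>2 = y\<^sup>2" using inj_onD[OF inj] sq x y by auto
      moreover have "\<psi> (x\<^sup>2) \<noteq> 0" using FG[OF x] by auto
      ultimately show "x = y" using e x y by (auto simp: power2_eq_iff)
    qed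
    then show "inj_on (\<lambda>z. 1 / z + (deriv \<psi> 0 * z + z\<^sup>2 * (z * \<kappa> (z\<^sup>2)))) (ball 0 1 - {0})"
      by (rule inj_on_cong[THEN iffD2, rotated]) (use G in auto)
  qed
  moreover have "deriv (deriv F) 0 = - 4 * deriv \<psi> 0"
  proof -
    have "deriv \<phi> 0 = - (2 * deriv \<psi> 0)" using d by (simp add: eq_neg_iff_add_eq_0 add.commute)
    then show ?thesis using deriv_deriv_mult_id[OF \<phi>(1,2)] by simp
  qed
  ultimately show ?thesis by (simp add: norm_mult)
qed

text \<open>Bieberbach's bound for \<open>z \<mapsto> (F ((z + a) / (1 + cnj a z)) - F a) / ((1 - \<bar>a\<bar>\<^sup>2) F' a)\<close>.\<close>
lemma koebe_transform_bound:
  fixes a :: complex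
  assumes F: "F holomorphic_on ball 0 1" and inj: "inj_on F (ball 0 1)" and a: "norm a < 1"
  shows "norm ((1 - (norm a)\<^sup>2) * (deriv (deriv F) a / deriv F a) - 2 * cnj a) \<le> 4"
proof -
  define M where "M = Moebius_function 0 (-a)"
  define m :: complex where "m = of_real (1 - (norm a)\<^sup>2)"
  have M: "M z = (z + a) / (1 + cnj a * z)" for z by (simp add: M_def Moebius_function_simple)
  have Mb: "M z \<in> ball 0 1" if "z \<in> ball 0 1" for z
    using Moebius_function_norm_lt_1[of "-a" z] a that by (simp add: M_def)
  have holM: "M holomorphic_on ball 0 1" unfolding M_def
    by (rule Moebius_function_holomorphic) (use a in simp)
  have m: "m = 1 - a * cnj a" by (simp add: m_def complex_norm_square[symmetric])
  have "(norm a)\<^sup>2 < 1" using a by (simp add: power_less_one_iff)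
  then have m0: "m \<noteq> 0" unfolding m_def by (metis diff_gt_0_iff_gt less_irrefl of_real_eq_0_iff)
  have nz: "1 + cnj a * z \<noteq> 0" if "z \<in> ball 0 1" for z
  proof
    assume "1 + cnj a * z = 0"
    then have "norm (cnj a * z) = 1" by (metis add_eq_0_iff norm_minus_cancel norm_one)
    moreover have "norm a * norm z < 1" using norm_mult_less[of a 1 z 1] a that by (simp add: norm_mult)
    ultimately show False by (simp add: norm_mult)
  qed
  have dF: "deriv F a \<noteq> 0" by (rule holomorphic_injective_imp_regular[OF F open_ball inj]) (use a in auto)
  define K where "K z = (F (M z) - F a) / (m * deriv F a)" for z
  have holK: "K holomorphic_on ball 0 1" unfolding K_def
    using m0 dF Mb by (intro holomorphic_intros holomorphic_on_compose_gen[OF holM F, unfolded o_def]) auto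
  have injK: "inj_on K (ball 0 1)"
  proof (rule inj_onI)
    fix x y assume xy: "x \<in> ball 0 1" "y \<in> ball 0 1" and "K x = K y"
    then have "F (M x) = F (M y)" using m0 dF by (simp add: K_def)
    then have "M x = M y" by (rule inj_onD[OF inj _ Mb[OF xy(1)] Mb[OF xy(2)]])
    then show "x = y"
      using Moebius_function_compose[OF refl a] xy unfolding M_def mem_ball_0 by metis
  qed
  have dM: "(M has_field_derivative m / (1 + cnj a * z)\<^sup>2) (at z)" if "z \<in> ball 0 1" for z
  proof -
    have "(M has_field_derivative (1 * (1 + cnj a * z) - (z + a) * cnj a) / ((1 + cnj a * z) * (1 + cnj a * z))) (at z)"
      unfolding M[abs_def]
    proof (rule DERIV_divide)
      show "((\<lambda>z. z + a) has_field_derivative 1) (at z)" by (auto intro!: derivative_eq_intros)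
      show "((\<lambda>z. 1 + cnj a * z) has_field_derivative cnj a) (at z)" by (auto intro!: derivative_eq_intros)
    qed (rule nz[OF that])
    also have "1 * (1 + cnj a * z) - (z + a) * cnj a = m" by (simp add: m algebra_simps)
    finally show ?thesis by (simp add: power2_eq_square)
  qed
  have dK: "(K has_field_derivative deriv F (M z) / ((1 + cnj a * z)\<^sup>2 * deriv F a)) (at z)"
    if "z \<in> ball 0 1" for z
  proof -
    have "((\<lambda>z. F (M z)) has_field_derivative deriv F (M z) * (m / (1 + cnj a * z)\<^sup>2)) (at z)"
      by (rule DERIV_chain2[OF holomorphic_derivI[OF F open_ball Mb[OF that]] dM[OF that]])
    then show ?thesis unfolding K_def[abs_def] using m0 dF
      by (auto intro!: derivative_eq_intros)
  qed
  have holF': "deriv F holomorphic_on ball 0 1" by (rule holomorphic_deriv[OF F open_ball])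
  have M0: "M 0 = a" by (simp add: M)
  \<comment> \<open>The closed formula \<open>dK\<close> for the first derivative holds on the whole
    disc, so differentiating it at 0 gives the second derivative of \<open>K\<close>.\<close>
  have "((\<lambda>z. deriv F (M z)) has_field_derivative deriv (deriv F) a * m) (at 0)"
    using DERIV_chain2[OF holomorphic_derivI[OF holF' open_ball Mb] dM, of 0] M0 by simp
  moreover have "((\<lambda>z. (1 + cnj a * z)\<^sup>2 * deriv F a) has_field_derivative 2 * cnj a * deriv F a) (at 0)"
    by (auto intro!: derivative_eq_intros)
  ultimately have "((\<lambda>z. deriv F (M z) / ((1 + cnj a * z)\<^sup>2 * deriv F a)) has_field_derivative
      (deriv (deriv F) a * m * deriv F a - deriv F a * (2 * cnj a * deriv F a)) / (deriv F a * deriv F a)) (at 0)"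
    using DERIV_divide[of "\<lambda>z. deriv F (M z)" _ 0 UNIV "\<lambda>z. (1 + cnj a * z)\<^sup>2 * deriv F a"] dF
    by (simp add: M0)
  also have "(deriv (deriv F) a * m * deriv F a - deriv F a * (2 * cnj a * deriv F a)) / (deriv F a * deriv F a)
      = m * (deriv (deriv F) a / deriv F a) - 2 * cnj a"
    using dF by (simp add: diff_divide_distrib)
  finally have "((\<lambda>z. deriv F (M z) / ((1 + cnj a * z)\<^sup>2 * deriv F a)) has_field_derivative
      m * (deriv (deriv F) a / deriv F a) - 2 * cnj a) (at 0)" .
  then have "(deriv K has_field_derivative m * (deriv (deriv F) a / deriv F a) - 2 * cnj a) (at 0)"
    by (rule has_field_derivative_transform_within_open[where S = "ball 0 1"])
       (use dK[THEN DERIV_imp_deriv] in auto)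
  then have "deriv (deriv K) 0 = m * (deriv (deriv F) a / deriv F a) - 2 * cnj a" by (rule DERIV_imp_deriv)
  moreover have "deriv K 0 = 1" using dK[of 0] dF by (simp add: DERIV_imp_deriv M0)
  moreover have "K 0 = 0" by (simp add: K_def M0)
  ultimately show ?thesis
    using bieberbach_second_coeff[OF holK injK] by (simp add: m_def)
qed

text \<open>The transform bound limits the radial derivative of \<open>log \<bar>F'\<bar>\<close> by
  \<open>(2 * t + 4) / (1 - t\<^sup>2)\<close>, the derivative of
  \<open>ln (1 + t) - 3 * ln (1 - t)\<close>; integration along the radius gives the claim.\<close>

theorem koebe_distortion_upper:
  fixes z :: complex
  assumes F: "F holomorphic_on ball 0 1" and inj: "inj_on F (ball 0 1)"
    and F0: "deriv F 0 = 1" and z: "norm z < 1"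
  shows "norm (deriv F z) \<le> (1 + norm z) / (1 - norm z) ^ 3"
proof -
  have nz: "deriv F x \<noteq> 0" if "x \<in> ball 0 1" for x
    by (rule holomorphic_injective_imp_regular[OF F open_ball inj that])
  have holF': "deriv F holomorphic_on ball 0 1" by (rule holomorphic_deriv[OF F open_ball])
  obtain l where l: "l holomorphic_on ball 0 1" "\<And>z. z \<in> ball 0 1 \<Longrightarrow> deriv F z = exp (l z)"
    using contractible_imp_holomorphic_log[OF holF'] nz convex_imp_contractible convex_ball by metis
  have l': "deriv l x = deriv (deriv F) x / deriv F x" if "x \<in> ball 0 1" for x
  proof -
    have "((\<lambda>z. exp (l z)) has_field_derivative exp (l x) * deriv l x) (at x)"
      by (auto intro!: derivative_eq_intros holomorphic_derivI[OF l(1) open_ball that])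
    then have "(deriv F has_field_derivative exp (l x) * deriv l x) (at x)"
      by (rule has_field_derivative_transform_within_open[where S = "ball 0 1"]) (use l(2) that in auto)
    then show ?thesis using l(2)[OF that] by (simp add: DERIV_imp_deriv)
  qed
  define r where "r = norm z"
  obtain u where u: "z = of_real r * u" "norm u = 1"
  proof (cases "z = 0")
    case True then show ?thesis using that[of 1] by (simp add: r_def)
  next
    case False then show ?thesis using that[of "z / of_real r"] by (simp add: r_def norm_divide)
  qed
  have r: "0 \<le> r" "r < 1" using z by (auto simp: r_def)
  define p where "p t = Re (l (of_real t * u)) - (ln (1 + t) - 3 * ln (1 - t))" for t
  have "p r \<le> p 0"
  proof (rule DERIV_nonpos_imp_nonincreasing[OF r(1)])
    fix t assume t: "0 \<le> t" "t \<le> r"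
    define a where "a = of_real t * u"
    have na: "norm a = t" using t u by (simp add: a_def norm_mult)
    then have ab: "a \<in> ball 0 1" using t r by simp
    have "((\<lambda>t. l (of_real t * u)) has_vector_derivative (u * deriv l a)) (at t)"
    proof -
      have "((\<lambda>t. of_real t * u) has_vector_derivative u) (at t)"
        by (auto intro!: derivative_eq_intros)
      from field_vector_diff_chain_at[OF this, of l] holomorphic_derivI[OF l(1) open_ball ab]
      show ?thesis by (simp add: o_def a_def)
    qed
    then have dRe: "((\<lambda>t. Re (l (of_real t * u))) has_real_derivative Re (u * deriv l a)) (at t)"
      by (simp add: has_vector_derivative_complex_iff)
    have "(p has_real_derivative Re (u * deriv l a) - (1 / (1 + t) + 3 / (1 - t))) (at t)"
      unfolding p_def[abs_def]
      by (rule DERIV_diff[OF dRe]) (use t r in \<open>auto intro!: derivative_eq_intros\<close>)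
    moreover have "Re (u * deriv l a) \<le> 1 / (1 + t) + 3 / (1 - t)"
    proof -
      have ua: "u * cnj a = of_real t" using u complex_norm_square[of u] by (simp add: a_def)
      have "norm (of_real (1 - t\<^sup>2) * deriv l a - 2 * cnj a) \<le> 4"
        using koebe_transform_bound[OF F inj, of a] ab na l'[OF ab] by simp
      \<comment> \<open>Multiplication by the direction \<open>u\<close> makes
        \<open>u * cnj a\<close> the real number \<open>t\<close> and \<open>u * deriv l a\<close>
        the derivative along the radius.\<close>
      then have "norm (u * (of_real (1 - t\<^sup>2) * deriv l a - 2 * cnj a)) \<le> 4"
        using u by (simp add: norm_mult)
      then have "Re (u * (of_real (1 - t\<^sup>2) * deriv l a - 2 * cnj a)) \<le> 4"
        using complex_Re_le_cmod order_trans by blast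
      also have "u * (of_real (1 - t\<^sup>2) * deriv l a - 2 * cnj a) =
          of_real (1 - t\<^sup>2) * (u * deriv l a) - of_real (2 * t)"
        using ua by (simp add: algebra_simps)
      also have "Re \<dots> = (1 - t\<^sup>2) * Re (u * deriv l a) - 2 * t"
        by (simp del: of_real_diff of_real_power)
      finally have "(1 - t\<^sup>2) * Re (u * deriv l a) \<le> 2 * t + 4" by simp
      moreover have "1 - t\<^sup>2 > 0" using t r by (simp add: power_less_one_iff)
      ultimately have "Re (u * deriv l a) \<le> (2 * t + 4) / (1 - t\<^sup>2)" by (simp add: field_simps)
      also have "\<dots> = 1 / (1 + t) + 3 / (1 - t)"
      proof -
        have "1 - t\<^sup>2 = (1 + t) * (1 - t)" by (simp add: algebra_simps power2_eq_square)
        then show ?thesis using t r by (simp add: divide_simps)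
      qed
      finally show ?thesis .
    qed
    ultimately show "\<exists>y. (p has_real_derivative y) (at t) \<and> y \<le> 0" by force
  qed
  moreover have "Re (l 0) = 0" using l(2)[of 0] F0 norm_exp_eq_Re[of "l 0"] by simp
  ultimately have "Re (l z) \<le> ln (1 + r) - 3 * ln (1 - r)" by (simp add: p_def u(1))
  then have "exp (Re (l z)) \<le> exp (ln (1 + r) - 3 * ln (1 - r))" by simp
  also have "\<dots> = (1 + r) / (1 - r) ^ 3"
    using r exp_of_nat_mult[of 3 "ln (1 - r)"] by (simp add: exp_diff)
  finally show ?thesis using l(2)[of z] z by (simp add: r_def)
qed

text \<open>The distortion bound is integrated along the radius;
  \<open>(1 + t) / (1 - t) ^ 3\<close> is the derivative of
  \<open>t / (1 - t)\<^sup>2\<close>.\<close>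

theorem koebe_growth_upper:
  fixes z :: complex
  assumes F: "F holomorphic_on ball 0 1" and inj: "inj_on F (ball 0 1)"
    and F0: "F 0 = 0" "deriv F 0 = 1" and z: "norm z < 1"
  shows "norm (F z) \<le> norm z / (1 - norm z) ^ 2"
proof (cases "z = 0")
  case False
  define r where "r = norm z"
  define u where "u = z / of_real r"
  have r: "0 < r" "r < 1" using z False by (auto simp: r_def)
  have u: "z = of_real r * u" "norm u = 1" using False by (auto simp: r_def u_def norm_divide)
  have b: "of_real t * u \<in> ball 0 1" if "0 \<le> t" "t \<le> r" for t using that r u by (simp add: norm_mult)
  have der: "((\<lambda>t. F (of_real t * u)) has_vector_derivative (u * deriv F (of_real t * u))) (at t)"
    if "0 \<le> t" "t \<le> r" for t
  proof -
    have "((\<lambda>t. of_real t * u) has_vector_derivative u) (at t)"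
      by (auto intro!: derivative_eq_intros)
    from field_vector_diff_chain_at[OF this, of F] holomorphic_derivI[OF F open_ball b[OF that]]
    show ?thesis by (simp add: o_def)
  qed
  have der2: "((\<lambda>t. t / (1 - t)\<^sup>2) has_vector_derivative ((1 + t) / (1 - t) ^ 3)) (at t)"
    if "0 \<le> t" "t \<le> r" for t
  proof -
    have nz: "1 - t \<noteq> 0" using that r by simp
    have *: "((\<lambda>t. t / (1 - t)\<^sup>2) has_real_derivative
        (1 * (1 - t)\<^sup>2 - t * (- 2 * (1 - t))) / ((1 - t)\<^sup>2 * (1 - t)\<^sup>2)) (at t)"
    proof (rule DERIV_divide)
      show "((\<lambda>t. (1 - t)\<^sup>2) has_real_derivative - 2 * (1 - t)) (at t)"
        by (auto intro!: derivative_eq_intros)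
    qed (use nz in auto)
    have "(1 * x\<^sup>2 - t * (- 2 * x)) / (x\<^sup>2 * x\<^sup>2) = (x + 2 * t) / x ^ 3" if "x \<noteq> 0" for x
      using that by (simp add: field_simps power2_eq_square power3_eq_cube)
    note this[OF nz]
    also have "1 - t + 2 * t = 1 + t" by simp
    finally show ?thesis using *
      by (simp only: has_real_derivative_iff_has_vector_derivative)
  qed
  have "norm (F (of_real r * u) - F (of_real 0 * u)) \<le> r / (1 - r)\<^sup>2 - 0 / (1 - 0)\<^sup>2"
  proof (rule differentiable_bound_general[where f = "\<lambda>t. F (of_real t * u)" and
         \<phi> = "\<lambda>t. t / (1 - t)\<^sup>2" and f' = "\<lambda>t. u * deriv F (of_real t * u)" and \<phi>' = "\<lambda>t. (1 + t) / (1 - t) ^ 3"])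
    show "continuous_on {0..r} (\<lambda>t. F (of_real t * u))"
      using der by (meson atLeastAtMost_iff continuous_at_imp_continuous_on has_vector_derivative_continuous)
    show "continuous_on {0..r} (\<lambda>t. t / (1 - t)\<^sup>2)"
      using r by (intro continuous_intros) auto
    fix t assume t: "0 < t" "t < r"
    show "norm (u * deriv F (of_real t * u)) \<le> (1 + t) / (1 - t) ^ 3"
      using koebe_distortion_upper[OF F inj F0(2), of "of_real t * u"] t u b[of t] by (simp add: norm_mult)
    show "((\<lambda>t. F (of_real t * u)) has_vector_derivative u * deriv F (of_real t * u)) (at t)"
      by (rule der) (use t in auto)
    show "((\<lambda>t. t / (1 - t)\<^sup>2) has_vector_derivative (1 + t) / (1 - t) ^ 3) (at t)"
      by (rule der2) (use t in auto)
  qed (rule r)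
  then show ?thesis unfolding u(1)[symmetric] using F0 by (simp add: r_def)
qed (simp add: F0)

section \<open>The Bohr-type radius for stable harmonic maps\<close>

lemma stable_univalent_imp_analytic:
  assumes "stable_univalent h g" "norm c = 1"
  shows "inj_on (\<lambda>z. h z + c * g z) (ball 0 1)"
proof (rule inj_onI)
  fix x y assume xy: "x \<in> ball 0 1" "y \<in> ball 0 1" and e: "h x + c * g x = h y + c * g y"
  define d where "d = g x - g y"
  have hd: "h x - h y = - c * d" using e by (simp add: d_def algebra_simps)
  \<comment> \<open>The factor \<mu> depends on the pair \<open>x\<close>, \<open>y\<close>, so
    injectivity for every unimodular \<mu> enters even for one fixed \<open>c\<close>.\<close>
  obtain \<mu> where \<mu>: "norm \<mu> = 1" "\<mu> * cnj d = c * d"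
  proof (cases "d = 0")
    case False
    then show ?thesis using that[of "c * d / cnj d"] assms(2) by (simp add: norm_mult norm_divide)
  qed (use that[of 1] in simp)
  have "h x - h y + (\<mu> * cnj (g x) - \<mu> * cnj (g y)) = h x - h y + \<mu> * cnj d"
    by (simp add: d_def algebra_simps)
  also have "\<dots> = 0" using \<mu>(2) hd by simp
  finally have "h x + \<mu> * cnj (g x) = h y + \<mu> * cnj (g y)" by (simp add: algebra_simps)
  moreover have "inj_on (\<lambda>z. h z + \<mu> * cnj (g z)) (ball 0 1)"
    using assms(1) \<mu>(1) by (simp add: stable_univalent_def)
  ultimately show "x = y" using xy by (simp add: inj_on_def)
qed

lemma exists_rotation_norm_add:
  fixes a b :: complex
  obtains c where "norm c = 1" "norm (a + c * b) = norm a + norm b"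
proof (cases "a = 0 \<or> b = 0")
  case True
  then show ?thesis using that[of 1] by auto
next
  case False
  define c where "c = (a / norm a) / (b / norm b)"
  have "a + c * b = a * of_real (1 + norm b / norm a)"
    using False by (simp add: c_def field_simps)
  then have "norm (a + c * b) = norm a * \<bar>1 + norm b / norm a\<bar>" by (simp only: norm_mult norm_of_real)
  also have "\<dots> = norm a * (1 + norm b / norm a)" by (subst abs_of_nonneg) auto
  also have "\<dots> = norm a + norm b" using False by (simp add: field_simps)
  finally have "norm (a + c * b) = norm a + norm b" .
  moreover have "norm c = 1" using False by (simp add: c_def norm_divide norm_mult)
  ultimately show ?thesis by (rule that[rotated])
qed

text \<open>For unimodular \<open>c\<close> the function \<open>h + c * g\<close> is univalent and
  normalised, as \<open>g\<close> and its derivative vanish at 0. The factor \<open>c\<close> is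
  chosen for the given \<open>z\<close>, separately for each bound.\<close>

lemma stable_univalent_bounds:
  fixes z :: complex
  assumes S: "in_S0H h g" and st: "stable_univalent h g" and z: "norm z < 1"
  shows "norm (h z) + norm (g z) \<le> norm z / (1 - norm z)\<^sup>2"
    and "norm (deriv h z) + norm (deriv g z) \<le> (1 + norm z) / (1 - norm z) ^ 3"
proof -
  have hol: "h holomorphic_on ball 0 1" "g holomorphic_on ball 0 1"
    and 0: "h 0 = 0" "deriv h 0 = 1" "g 0 = 0" "deriv g 0 = 0"
    using S by (auto simp: in_S0H_def)
  have dF: "deriv (\<lambda>z. h z + c * g z) w = deriv h w + c * deriv g w" if "norm w < 1" for c w
    by (rule DERIV_imp_deriv)
       (use that in \<open>auto intro!: derivative_eq_intros holomorphic_derivI[OF hol(1) open_ball]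
          holomorphic_derivI[OF hol(2) open_ball]\<close>)
  have F: "(\<lambda>z. h z + c * g z) holomorphic_on ball 0 1" for c by (intro holomorphic_intros hol)
  have inj: "inj_on (\<lambda>z. h z + c * g z) (ball 0 1)" if "norm c = 1" for c
    by (rule stable_univalent_imp_analytic[OF st that])
  obtain c where c: "norm c = 1" "norm (h z + c * g z) = norm (h z) + norm (g z)"
    by (rule exists_rotation_norm_add)
  show "norm (h z) + norm (g z) \<le> norm z / (1 - norm z)\<^sup>2"
    using koebe_growth_upper[OF F inj[OF c(1)] _ _ z] c(2) 0 dF[of 0 c] by simp
  obtain c where c: "norm c = 1" "norm (deriv h z + c * deriv g z) = norm (deriv h z) + norm (deriv g z)"
    by (rule exists_rotation_norm_add)
  show "norm (deriv h z) + norm (deriv g z) \<le> (1 + norm z) / (1 - norm z) ^ 3"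
    using koebe_distortion_upper[OF F inj[OF c(1)] _ z] c(2) 0 dF[of 0 c] dF[OF z, of c] by simp
qed

text \<open>The quotient \<phi> of \<omega> by \<open>z ^ n\<close> is bounded on the circle of
  radius \<rho> by \<open>1 / \<rho> ^ n\<close>; the maximum principle carries this inside, and
  \<rho> tends to 1.\<close>

lemma schwarz_B_bound:
  fixes z :: complex
  assumes B: "schwarz_B n \<omega>" and n: "n \<ge> 1" and z: "norm z < 1"
  shows "norm (\<omega> z) \<le> norm z ^ n"
proof -
  have hol: "\<omega> holomorphic_on ball 0 1" and le: "\<And>z. z \<in> ball 0 1 \<Longrightarrow> norm (\<omega> z) \<le> 1"
    and d0: "\<And>k. k < n \<Longrightarrow> (deriv ^^ k) \<omega> 0 = 0" and dn: "(deriv ^^ n) \<omega> 0 \<noteq> 0"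
    using B by (auto simp: schwarz_B_def)
  have \<omega>0: "\<omega> 0 = 0" using d0[of 0] n by simp
  obtain g r where r: "0 < r" and g: "g holomorphic_on ball 0 r"
    and eq: "\<And>w. w \<in> ball 0 r \<Longrightarrow> \<omega> w = w ^ n * g w"
  proof (rule holomorphic_factor_order_of_zero[OF hol open_ball, of 0 n])
    show "(deriv ^^ n) \<omega> 0 \<noteq> 0" by (rule dn)
  qed (use n d0 \<omega>0 in auto)
  \<comment> \<open>The value at 0 comes from the local factorisation; \<phi> is holomorphic on the
    punctured disc as a quotient and near 0 because it equals \<open>g\<close> there.\<close>
  define \<phi> where "\<phi> w = (if w = 0 then g 0 else \<omega> w / w ^ n)" for w
  have "\<phi> holomorphic_on (ball 0 1 - {0}) \<union> ball 0 (min r 1)"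
  proof (rule holomorphic_on_Un)
    show "\<phi> holomorphic_on ball 0 1 - {0}"
      by (rule holomorphic_transform[of "\<lambda>w. \<omega> w / w ^ n"])
         (auto simp: \<phi>_def intro!: holomorphic_intros holomorphic_on_subset[OF hol])
    show "\<phi> holomorphic_on ball 0 (min r 1)"
      by (rule holomorphic_transform[OF holomorphic_on_subset[OF g]]) (auto simp: \<phi>_def eq)
  qed auto
  then have hol\<phi>: "\<phi> holomorphic_on ball 0 1"
    by (rule holomorphic_on_subset) (use r in auto)
  have \<omega>\<phi>: "\<omega> w = w ^ n * \<phi> w" if "w \<in> ball 0 1" for w
    using n \<omega>0 by (simp add: \<phi>_def zero_power)
  have b: "norm (\<phi> z) * \<rho> ^ n \<le> 1" if \<rho>: "norm z < \<rho>" "\<rho> < 1" for \<rho>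
  proof -
    have \<rho>0: "\<rho> > 0" using \<rho>(1) norm_ge_zero[of z] by linarith
    have "norm (\<phi> z) \<le> 1 / \<rho> ^ n"
    proof (rule maximum_modulus_frontier[where S = "ball 0 \<rho>" and f = \<phi>])
      show "\<phi> holomorphic_on interior (ball 0 \<rho>)"
        by (rule holomorphic_on_subset[OF hol\<phi>]) (use \<rho> in auto)
      show "continuous_on (closure (ball 0 \<rho>)) \<phi>"
        by (rule continuous_on_subset[OF holomorphic_on_imp_continuous_on[OF hol\<phi>]]) (use \<rho> \<rho>0 in auto)
      fix w :: complex assume "w \<in> frontier (ball 0 \<rho>)"
      then have w: "norm w = \<rho>" using \<rho>0 by auto
      then have "norm (\<omega> w) \<le> 1" using le[of w] \<rho> by simp
      then show "norm (\<phi> w) \<le> 1 / \<rho> ^ n"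
        using \<omega>\<phi>[of w] w \<rho> \<rho>0 by (simp add: norm_mult norm_power field_simps)
    qed (use \<rho> in auto)
    then show ?thesis using \<rho>0 by (simp add: field_simps)
  qed
  have "norm (\<phi> z) * 1 ^ n \<le> 1"
  proof (rule tendsto_upperbound[of _ _ "at_left 1"])
    show "((\<lambda>\<rho>. norm (\<phi> z) * \<rho> ^ n) \<longlongrightarrow> norm (\<phi> z) * 1 ^ n) (at_left 1)" by (intro tendsto_intros)
    have "\<forall>\<^sub>F \<rho> in at_left 1. \<rho> \<in> {norm z<..<1}" by (rule eventually_at_left_real) (use z in auto)
    then show "\<forall>\<^sub>F \<rho> in at_left 1. norm (\<phi> z) * \<rho> ^ n \<le> 1" by eventually_elim (use b in auto)
  qed simp
  then show ?thesis
    using \<omega>\<phi>[of z] z by (simp add: norm_mult norm_power mult_left_le)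
qed

lemma schwarz_B_power: "schwarz_B n (\<lambda>z. z ^ n)"
  unfolding schwarz_B_def
proof (intro conjI allI impI ballI)
  \<comment> \<open>The factor \<open>0 ^ (n - k)\<close> is 0 for \<open>k < n\<close> and 1 for
    \<open>k = n\<close>, where the Pochhammer factor is the factorial of \<open>n\<close>.\<close>
  have d: "(deriv ^^ k) (\<lambda>z::complex. z ^ n) 0 = pochhammer (of_nat (Suc n - k)) k * 0 ^ (n - k)" for k
    using higher_deriv_power[of k 0 n 0] by simp
  show "(deriv ^^ k) (\<lambda>z::complex. z ^ n) 0 = 0" if "k < n" for k using that by (simp add: d)
  show "(deriv ^^ n) (\<lambda>z::complex. z ^ n) 0 \<noteq> 0"
    by (simp add: d pochhammer_fact[symmetric])
  show "norm (z ^ n) \<le> 1" if "z \<in> ball 0 1" for z :: complex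
    using that by (simp add: norm_power power_le_one)
qed (intro holomorphic_intros)

section \<open>The Koebe function as extremal map\<close>

definition koebe :: "complex \<Rightarrow> complex" where
  "koebe z = z / (1 - z)\<^sup>2"

lemma koebe_deriv:
  assumes "norm z < 1"
  shows "(koebe has_field_derivative (1 + z) / (1 - z) ^ 3) (at z)"
proof -
  have nz: "1 - z \<noteq> 0" using assms by auto
  have *: "(koebe has_field_derivative
      (1 * (1 - z)\<^sup>2 - z * (- 2 * (1 - z))) / ((1 - z)\<^sup>2 * (1 - z)\<^sup>2)) (at z)"
    unfolding koebe_def[abs_def]
  proof (rule DERIV_divide)
    show "((\<lambda>z. (1 - z)\<^sup>2) has_field_derivative - 2 * (1 - z)) (at z)"
      by (auto intro!: derivative_eq_intros)
  qed (use nz in auto)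
  have "(1 * x\<^sup>2 - z * (- 2 * x)) / (x\<^sup>2 * x\<^sup>2) = (x + 2 * z) / x ^ 3" if "x \<noteq> 0" for x
    using that by (simp add: field_simps power2_eq_square power3_eq_cube)
  note this[OF nz]
  also have "1 - z + 2 * z = 1 + z" by simp
  finally show ?thesis using * by (simp only:)
qed

text \<open>Clearing denominators in a coincidence leaves \<open>(z - w) * (1 - z * w) = 0\<close>,
  and the second factor has no zero in the disc.\<close>

lemma koebe_inj: "inj_on koebe (ball 0 1)"
proof (rule inj_onI)
  fix z w :: complex assume zw: "z \<in> ball 0 1" "w \<in> ball 0 1" and e: "koebe z = koebe w"
  have nz: "(1 - z)\<^sup>2 \<noteq> 0" "(1 - w)\<^sup>2 \<noteq> 0" using zw by auto
  have "z * (1 - w)\<^sup>2 = w * (1 - z)\<^sup>2" using e nz unfolding koebe_def by (metis frac_eq_eq)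
  then have "(z - w) * (1 - z * w) = 0" by (simp add: algebra_simps power2_eq_square)
  moreover have "norm (z * w) < 1" using norm_mult_less[of z 1 w 1] zw by simp
  then have "1 - z * w \<noteq> 0" by auto
  ultimately show "z = w" by simp
qed

lemma koebe_in_S0H: "in_S0H koebe (\<lambda>_. 0)"
  unfolding in_S0H_def
proof (intro conjI ballI)
  show "koebe holomorphic_on ball 0 1"
    unfolding holomorphic_on_open[OF open_ball] by (metis koebe_deriv mem_ball_0)
  show "deriv koebe 0 = 1" using koebe_deriv[of 0] by (simp add: DERIV_imp_deriv)
  show "norm (deriv (\<lambda>_. 0) z) < norm (deriv koebe z)" if z: "z \<in> ball 0 1" for z
  proof -
    have "1 + z \<noteq> 0" using z by (auto simp: add_eq_0_iff)
    moreover have "1 - z \<noteq> 0" using z by auto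
    ultimately show ?thesis
      using koebe_deriv[of z] z by (simp add: DERIV_imp_deriv)
  qed
  show "koebe 0 = 0" by (simp add: koebe_def)
qed (use koebe_inj in auto)

lemma koebe_stable: "stable_univalent koebe (\<lambda>_. 0)"
  using koebe_inj by (simp add: stable_univalent_def)

text \<open>The Koebe bound for the modulus of \<open>z * F' z\<close> at \<open>norm z = x\<close>;
  the leading factor \<open>x\<close> comes from the operators \<open>Dop\<close> and
  \<open>Dscr\<close>.\<close>

definition distortion :: "real \<Rightarrow> real" where
  "distortion x = x * ((1 + x) / (1 - x) ^ 3)"

definition growth :: "real \<Rightarrow> real" where
  "growth x = x / (1 - x)\<^sup>2"

lemma F3_eq: "F3 s m p q r = distortion (r ^ m) ^ s + growth (r ^ q) ^ p - 1"
  by (simp add: F3_def distortion_def growth_def power_mult_distrib power_divide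
      power_mult[symmetric] mult.commute)

lemma distortion_mono: "0 \<le> x \<Longrightarrow> x \<le> y \<Longrightarrow> y < 1 \<Longrightarrow> distortion x \<le> distortion y"
  unfolding distortion_def by (intro mult_mono frac_le power_mono) auto

lemma growth_mono: "0 \<le> x \<Longrightarrow> x \<le> y \<Longrightarrow> y < 1 \<Longrightarrow> growth x \<le> growth y"
  unfolding growth_def by (intro frac_le power_mono) auto

lemma distortion_strict_mono: "0 \<le> x \<Longrightarrow> x < y \<Longrightarrow> y < 1 \<Longrightarrow> distortion x < distortion y"
  unfolding distortion_def
  by (intro mult_strict_mono' frac_le divide_nonneg_pos frac_less power_mono) auto

lemma distortion_nonneg: "0 \<le> x \<Longrightarrow> x < 1 \<Longrightarrow> 0 \<le> distortion x"
  by (simp add: distortion_def)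

lemma growth_nonneg: "0 \<le> x \<Longrightarrow> 0 \<le> growth x"
  by (simp add: growth_def)

section \<open>The radius equation, the inequality and its sharpness\<close>

context
  fixes s m p q :: nat
  assumes pos: "s \<ge> 1" "m \<ge> 1" "p \<ge> 1" "q \<ge> 1"
begin

lemma F3_strict_mono:
  assumes "0 \<le> x" "x < y" "y < 1"
  shows "F3 s m p q x < F3 s m p q y"
proof -
  have m: "x ^ m < y ^ m" "y ^ m < 1" using assms pos by (auto intro: power_strict_mono simp: power_less_one_iff)
  have q: "x ^ q \<le> y ^ q" "y ^ q < 1" using assms pos by (auto intro: power_mono simp: power_less_one_iff)
  have "distortion (x ^ m) ^ s < distortion (y ^ m) ^ s"
    using distortion_strict_mono[of "x ^ m" "y ^ m"] distortion_nonneg[of "x ^ m"] m assms pos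
    by (intro power_strict_mono) auto
  moreover have "growth (x ^ q) ^ p \<le> growth (y ^ q) ^ p"
    using growth_mono[of "x ^ q" "y ^ q"] growth_nonneg[of "x ^ q"] q assms by (intro power_mono) auto
  ultimately show ?thesis by (simp add: F3_eq)
qed

lemma F3_ex1: "\<exists>!r. 0 < r \<and> r < 1 \<and> F3 s m p q r = 0"
proof -
  \<comment> \<open>At this point the first summand is already \<open>6 ^ s\<close>, so
    \<open>F3\<close> is nonnegative; at 0 it is -1, and on the interval between them the
    denominators do not vanish.\<close>
  define y where "y = root m (1/2)"
  have ym: "y ^ m = 1/2" using pos by (simp add: y_def)
  have y: "0 < y" "y < 1" using pos by (auto simp: y_def)
  have F0: "F3 s m p q 0 = -1" using pos by (simp add: F3_eq distortion_def growth_def zero_power)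
  have "distortion (y ^ m) = 6" by (simp add: ym distortion_def power3_eq_cube)
  then have "distortion (y ^ m) ^ s \<ge> 1" by (simp add: one_le_power)
  then have Fy: "F3 s m p q y \<ge> 0"
    using zero_le_power[OF growth_nonneg[of "y ^ q"], of p] y by (simp add: F3_eq)
  have lt1: "x ^ m < 1" "x ^ q < 1" if "0 \<le> x" "x \<le> y" for x
    using that y pos by (auto simp: power_less_one_iff)
  have "\<exists>x. 0 \<le> x \<and> x \<le> y \<and> F3 s m p q x = 0"
  proof (rule IVT')
    show "continuous_on {0..y} (F3 s m p q)"
      unfolding F3_eq[abs_def] distortion_def growth_def
      by (intro continuous_intros) (use lt1 in \<open>force+\<close>)
  qed (use F0 Fy y in auto)
  then obtain x where x: "0 \<le> x" "x \<le> y" "F3 s m p q x = 0" by blast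
  show ?thesis
  proof (rule ex1I[of _ x])
    show "0 < x \<and> x < 1 \<and> F3 s m p q x = 0" using x y F0 by (cases "x = 0") auto
    fix r assume r: "0 < r \<and> r < 1 \<and> F3 s m p q r = 0"
    show "r = x"
      using F3_strict_mono[of r x] F3_strict_mono[of x r] r x y by (cases r x rule: linorder_cases) auto
  qed
qed

lemma r3_root: "0 < r3 s m p q" "r3 s m p q < 1" "F3 s m p q (r3 s m p q) = 0"
  using theI'[OF F3_ex1] by (auto simp: r3_def)

text \<open>The triangle inequality removes the sign that distinguishes \<open>Dop\<close> from
  \<open>Dscr\<close>, so one argument covers both.\<close>

lemma r3_bound:
  fixes z :: complex
  assumes S: "in_S0H h g" and st: "stable_univalent h g"
    and \<omega>: "schwarz_B m \<omega>m" "schwarz_B q \<omega>q" and z: "norm z \<le> r3 s m p q"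
    and D: "D = Dop h g (\<omega>m z) \<or> D = Dscr h g (\<omega>m z)"
  shows "norm D ^ s + norm (harm h g (\<omega>q z)) ^ p \<le> 1"
proof -
  have z1: "norm z < 1" using z r3_root by simp
  have zm: "norm z ^ m < 1" "norm z ^ q < 1" using z1 pos by (auto simp: power_less_one_iff)
  define w where "w = \<omega>m z"
  define v where "v = \<omega>q z"
  have w: "norm w \<le> norm z ^ m" unfolding w_def by (rule schwarz_B_bound[OF \<omega>(1) pos(2) z1])
  have v: "norm v \<le> norm z ^ q" unfolding v_def by (rule schwarz_B_bound[OF \<omega>(2) pos(4) z1])
  have "norm D \<le> norm (w * deriv h w) + norm (cnj w * cnj (deriv g w))"
    using D by (auto simp: Dop_def Dscr_def w_def[symmetric] intro: norm_triangle_ineq norm_triangle_ineq4)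
  also have "\<dots> = norm w * (norm (deriv h w) + norm (deriv g w))"
    by (simp add: norm_mult distrib_left)
  also have "\<dots> \<le> distortion (norm w)" unfolding distortion_def
    by (intro mult_left_mono stable_univalent_bounds(2)[OF S st]) (use w zm in auto)
  also have "\<dots> \<le> distortion (norm z ^ m)" by (rule distortion_mono) (use w zm in auto)
  finally have 1: "norm D ^ s \<le> distortion (norm z ^ m) ^ s" by (rule power_mono) simp
  have "norm (harm h g v) \<le> norm (h v) + norm (g v)"
    using norm_triangle_ineq[of "h v" "cnj (g v)"] by (simp add: harm_def)
  also have "\<dots> \<le> growth (norm v)" unfolding growth_def
    by (intro stable_univalent_bounds(1)[OF S st]) (use v zm in auto)
  also have "\<dots> \<le> growth (norm z ^ q)" by (rule growth_mono) (use v zm in auto)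
  finally have 2: "norm (harm h g v) ^ p \<le> growth (norm z ^ q) ^ p" by (rule power_mono) simp
  have "F3 s m p q (norm z) \<le> 0"
    using F3_strict_mono[of "norm z" "r3 s m p q"] r3_root z by (cases "norm z = r3 s m p q") auto
  with 1 2 show ?thesis by (simp add: F3_eq v_def)
qed

text \<open>On the positive axis the Koebe function attains both bounds exactly, so the left side is
  \<open>F3 s m p q r + 1\<close>, and \<open>F3\<close> is positive beyond its root.\<close>

lemma r3_sharp:
  assumes r: "r3 s m p q < r" "r < 1"
  shows "norm (Dop koebe (\<lambda>_. 0) (of_real r ^ m)) ^ s + norm (harm koebe (\<lambda>_. 0) (of_real r ^ q)) ^ p > 1"
proof -
  have r0: "0 < r" using r r3_root by simp
  have lt: "r ^ m < 1" "r ^ q < 1" using r r0 pos by (auto simp: power_less_one_iff)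
  have "norm (Dop koebe (\<lambda>_. 0) (of_real x)) = distortion x" if "0 \<le> x" "x < 1" for x
  proof -
    have "Dop koebe (\<lambda>_. 0) (of_real x) = of_real (distortion x)"
      using koebe_deriv[of "of_real x"] that by (simp add: Dop_def DERIV_imp_deriv distortion_def)
    then show ?thesis using distortion_nonneg[OF that] by simp
  qed
  moreover have "norm (harm koebe (\<lambda>_. 0) (of_real x)) = growth x" if "0 \<le> x" "x < 1" for x
  proof -
    have "harm koebe (\<lambda>_. 0) (of_real x) = of_real (growth x)"
      by (simp add: harm_def koebe_def growth_def)
    then show ?thesis using growth_nonneg[OF that(1)] by simp
  qed
  ultimately show ?thesis
    using F3_strict_mono[of "r3 s m p q" r] r3_root r r0 lt by (simp add: F3_eq flip: of_real_power)
qed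

end

theorem theorem3p3:
  fixes s m p q :: nat
  assumes "s \<ge> 1" "m \<ge> 1" "p \<ge> 1" "q \<ge> 1"
  shows "(\<exists>!r. 0 < r \<and> r < 1 \<and> F3 s m p q r = 0)
    \<and> (\<forall>h g \<omega>m \<omega>q z. in_S0H h g \<and> stable_univalent h g \<and> schwarz_B m \<omega>m \<and> schwarz_B q \<omega>q
          \<and> norm z \<le> r3 s m p q \<longrightarrow>
          norm (Dop h g (\<omega>m z)) ^ s + norm (harm h g (\<omega>q z)) ^ p \<le> 1 \<and>
          norm (Dscr h g (\<omega>m z)) ^ s + norm (harm h g (\<omega>q z)) ^ p \<le> 1)
    \<and> (\<forall>r. r3 s m p q < r \<and> r < 1 \<longrightarrow>
          (\<exists>h g \<omega>m \<omega>q z. in_S0H h g \<and> stable_univalent h g \<and> schwarz_B m \<omega>m \<and> schwarz_B q \<omega>q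
             \<and> norm z = r \<and>
             norm (Dop h g (\<omega>m z)) ^ s + norm (harm h g (\<omega>q z)) ^ p > 1))
    \<and> (\<forall>r. r3 s m p q < r \<and> r < 1 \<longrightarrow>
          (\<exists>h g \<omega>m \<omega>q z. in_S0H h g \<and> stable_univalent h g \<and> schwarz_B m \<omega>m \<and> schwarz_B q \<omega>q
             \<and> norm z = r \<and>
             norm (Dscr h g (\<omega>m z)) ^ s + norm (harm h g (\<omega>q z)) ^ p > 1))"
proof -
  have "norm (of_real r :: complex) = r" if "r3 s m p q < r" for r
    using r3_root(1)[OF assms] that by simp
  \<comment> \<open>With \<open>g = 0\<close> both operators agree, so one extremal example settles
    both sharpness claims.\<close>
  moreover have "Dscr koebe (\<lambda>_. 0) = Dop koebe (\<lambda>_. 0)"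
    by (simp add: Dscr_def Dop_def fun_eq_iff)
  ultimately have sharp: "\<exists>h g \<omega>m \<omega>q z. in_S0H h g \<and> stable_univalent h g \<and> schwarz_B m \<omega>m \<and> schwarz_B q \<omega>q
       \<and> norm z = r \<and> norm (Dop h g (\<omega>m z)) ^ s + norm (harm h g (\<omega>q z)) ^ p > 1"
    "\<exists>h g \<omega>m \<omega>q z. in_S0H h g \<and> stable_univalent h g \<and> schwarz_B m \<omega>m \<and> schwarz_B q \<omega>q
       \<and> norm z = r \<and> norm (Dscr h g (\<omega>m z)) ^ s + norm (harm h g (\<omega>q z)) ^ p > 1"
    if "r3 s m p q < r" "r < 1" for r
    using that koebe_in_S0H koebe_stable schwarz_B_power r3_sharp[OF assms that]
    by (intro exI[of _ koebe] exI[of _ "\<lambda>_. 0"] exI[of _ "\<lambda>z. z ^ m"] exI[of _ "\<lambda>z. z ^ q"]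
        exI[of _ "of_real r"]; simp)+
  show ?thesis
    using F3_ex1[OF assms] r3_bound[OF assms] sharp by (intro conjI allI impI) blast+
qed

end
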